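(* Let $\mathbf{k}$ be a commutative ring, $q\in\mathbf{k}$, and let $a,b\in\mathbf{k}$ with $a+b=q-1$. Let $\lambda=(\lambda_1,\lambda_2,\dots)$ and $\mu=(\mu_1,\mu_2,\dots)$ be partitions, and set $\ell_i:=\lambda_i-i$ and $m_i:=\mu_i-i$ for each $i\ge 1$. Then \[ \nabla_q\left(s_{\lambda/\mu}\right)=\sum_{\substack{i\ge 1;\\ \lambda-e_i\text{ is a partition}}}(\ell_i+a)\,s_{(\lambda-e_i)/\mu}+\sum_{\substack{i\ge 1;\\ \mu+e_i\text{ is a partition}}}(b-m_i)\,s_{\lambda/(\mu+e_i)}. \]
   Context: $\Lambda$ is the ring of symmetric functions in infinitely many variables $x_1,x_2,\dots$ over $\mathbf{k}$; $h_n\in\Lambda$ is the $n$-th complete homogeneous symmetric function ($h_0=1$, $h_n=0$ for $n<0$). $\nabla_q:\Lambda\to\Lambda$ is the unique $\mathbf{k}$-linear derivation satisfying $\nabla_q(h_n)=(n+q-1)h_{n-1}$ for each $n>0$ (well defined since $h_1,h_2,\dots$ freely generate $\Lambda$ as a commutative $\mathbf{k}$-algebra). A partition is a weakly decreasing sequence of nonnegative integers with finitely many nonzero entries; $e_i$ is the sequence $(0,\dots,0,1,0,\dots)$ with $1$ in position $i$, and sequences are added/subtracted entrywise. $s_{\lambda/\mu}\in\Lambda$ is the skew Schur function (zero unless $\mu_i\le\lambda_i$ for all $i$). *)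

theory Defs
  imports "HOL-Library.Poly_Mapping" "HOL-Library.FuncSet"
begin

section \<open>Formal power series in countably many variables\<close>

text \<open>
  The variables \<open>x\<^sub>1, x\<^sub>2, \<dots>\<close> are indexed from \<open>0\<close>, so index \<open>i\<close> stands for
  \<open>x\<^bsub>i+1\<^esub>\<close>.  A monomial is its finitely supported exponent vector.
\<close>

abbreviation keys :: "('a \<Rightarrow>\<^sub>0 'b :: zero) \<Rightarrow> 'a set" where
  "keys \<equiv> Poly_Mapping.keys"

abbreviation lookup :: "('a \<Rightarrow>\<^sub>0 'b :: zero) \<Rightarrow> 'a \<Rightarrow> 'b" where
  "lookup \<equiv> Poly_Mapping.lookup"

type_synonym monomial = "nat \<Rightarrow>\<^sub>0 nat"

definition mon_degree :: "monomial \<Rightarrow> nat" where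
  "mon_degree m = (\<Sum>i\<in>keys m. lookup m i)"

typedef 'k mfps = "UNIV :: (monomial \<Rightarrow> 'k) set"
  morphisms coeff Abs_mfps by simp

setup_lifting type_definition_mfps

lemma mfps_eqI: "(\<And>m. coeff f m = coeff g m) \<Longrightarrow> f = g"
  by (metis coeff_inject ext)

lemma finite_splittings [simp]: "finite {(a, b). a + b = (m :: monomial)}"
proof -
  let ?F = "{u. \<forall>i. (i \<in> keys m \<longrightarrow> u i \<in> {..mon_degree m}) \<and> (i \<notin> keys m \<longrightarrow> u i = (0 :: nat))}"
  have fin: "finite ?F"
    by (rule finite_set_of_finite_funs) auto
  have bnd: "lookup a \<in> ?F" if "a + b = m" for a b
  proof -
    have "lookup a i \<le> lookup m i" for i
      using that by (auto simp: lookup_add)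
    moreover have "lookup m i \<le> mon_degree m" for i
    proof (cases "i \<in> keys m")
      case True
      then show ?thesis
        unfolding mon_degree_def by (intro member_le_sum) auto
    qed (simp add: in_keys_iff)
    ultimately show ?thesis
      by (auto simp: in_keys_iff intro: le_trans) (metis le_zero_eq)
  qed
  have "inj_on (\<lambda>p. lookup (fst p)) {(a, b). a + b = m}"
    by (auto simp: inj_on_def lookup_inject)
  moreover have "(\<lambda>p. lookup (fst p)) ` {(a, b). a + b = m} \<subseteq> ?F"
    using bnd by auto
  ultimately show ?thesis
    using fin by (metis (no_types, lifting) finite_imageD finite_subset)
qed

instantiation mfps :: (comm_ring_1) comm_ring_1
begin

lift_definition zero_mfps :: "'a mfps" is "\<lambda>m. 0" .

lift_definition one_mfps :: "'a mfps" is "\<lambda>m. if m = 0 then 1 else 0" .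

lift_definition plus_mfps :: "'a mfps \<Rightarrow> 'a mfps \<Rightarrow> 'a mfps" is "\<lambda>f g m. f m + g m" .

lift_definition minus_mfps :: "'a mfps \<Rightarrow> 'a mfps \<Rightarrow> 'a mfps" is "\<lambda>f g m. f m - g m" .

lift_definition uminus_mfps :: "'a mfps \<Rightarrow> 'a mfps" is "\<lambda>f m. - f m" .

lift_definition times_mfps :: "'a mfps \<Rightarrow> 'a mfps \<Rightarrow> 'a mfps"
  is "\<lambda>f g m. \<Sum>(a, b)\<in>{(a, b). a + b = m}. f a * g b" .

instance
proof
  fix f g h :: "'a mfps"
  show "f + g + h = f + (g + h)" "f + g = g + f" "0 + f = f" "- f + f = 0" "f - g = f + - g"
    by (transfer; simp add: fun_eq_iff algebra_simps)+
  show "f * g = g * f"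
  proof (rule mfps_eqI)
    fix m
    show "coeff (f * g) m = coeff (g * f) m"
      unfolding times_mfps.rep_eq
      by (rule sum.reindex_bij_witness[of _ prod.swap prod.swap]) (auto simp: ac_simps)
  qed
  show "(f + g) * h = f * h + g * h"
    by (transfer; simp add: fun_eq_iff distrib_right sum.distrib case_prod_unfold)
  show "1 * f = f"
  proof (rule mfps_eqI)
    fix m
    have "coeff (1 * f) m
        = (\<Sum>p\<in>{(a, b). a + b = m}. if p = (0, m) then coeff f m else 0)"
      unfolding times_mfps.rep_eq one_mfps.rep_eq by (intro sum.cong) (auto split: if_splits)
    also have "\<dots> = coeff f m"
      by simp
    finally show "coeff (1 * f) m = coeff f m" .
  qed
  show "f * g * h = f * (g * h)"
  proof (rule mfps_eqI)
    fix m
    let ?S = "\<lambda>n. {(a, b). a + b = (n :: monomial)}"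
    let ?L = "Sigma (?S m) (\<lambda>p. ?S (fst p))" and ?R = "Sigma (?S m) (\<lambda>p. ?S (snd p))"
    have "coeff (f * g * h) m
        = (\<Sum>p\<in>?S m. \<Sum>q\<in>?S (fst p). coeff f (fst q) * coeff g (snd q) * coeff h (snd p))"
      by (simp add: times_mfps.rep_eq case_prod_unfold sum_distrib_right)
    also have "\<dots> = (\<Sum>(p, q)\<in>?L. coeff f (fst q) * coeff g (snd q) * coeff h (snd p))"
      by (rule sum.Sigma) auto
    also have "\<dots> = (\<Sum>(p, q)\<in>?R. coeff f (fst p) * (coeff g (fst q) * coeff h (snd q)))"
      by (rule sum.reindex_bij_witness
            [of _ "\<lambda>(p, q). ((fst p + fst q, snd q), (fst p, fst q))"
                  "\<lambda>(p, q). ((fst q, snd q + snd p), (snd q, snd p))"])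
        (auto simp: ac_simps)
    also have "\<dots> = (\<Sum>p\<in>?S m. \<Sum>q\<in>?S (snd p). coeff f (fst p) * (coeff g (fst q) * coeff h (snd q)))"
      by (rule sum.Sigma[symmetric]) auto
    also have "\<dots> = coeff (f * (g * h)) m"
      by (simp add: times_mfps.rep_eq case_prod_unfold sum_distrib_left)
    finally show "coeff (f * g * h) m = coeff (f * (g * h)) m" .
  qed
  have "coeff 0 0 \<noteq> coeff (1 :: 'a mfps) 0"
    by (simp add: zero_mfps.rep_eq one_mfps.rep_eq)
  then show "(0 :: 'a mfps) \<noteq> 1"
    by metis
qed

end

lift_definition smult :: "'k :: comm_ring_1 \<Rightarrow> 'k mfps \<Rightarrow> 'k mfps" is "\<lambda>c f m. c * f m" .


section \<open>Symmetric functions\<close>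

definition symfuns :: "'k :: comm_ring_1 mfps set" where
  "symfuns = {f. (\<forall>\<pi>. bij \<pi> \<longrightarrow> (\<forall>m. coeff f (Poly_Mapping.map_key \<pi> m) = coeff f m)) \<and>
                 (\<exists>d. \<forall>m. coeff f m \<noteq> 0 \<longrightarrow> mon_degree m \<le> d)}"

text \<open>The complete homogeneous symmetric function: the sum of all monomials of degree \<open>n\<close>.\<close>

lift_definition hsym :: "nat \<Rightarrow> 'k :: comm_ring_1 mfps"
  is "\<lambda>n m. if mon_degree m = n then 1 else 0" .

text \<open>
  The property characterising the unique \<open>k\<close>-linear derivation \<open>\<nabla>\<^sub>q\<close> of the algebra of symmetric
  functions; the values of \<open>D\<close> outside \<^const>\<open>symfuns\<close> are left unconstrained.
\<close>

definition is_nabla :: "'k :: comm_ring_1 \<Rightarrow> ('k mfps \<Rightarrow> 'k mfps) \<Rightarrow> bool" where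
  "is_nabla q D \<longleftrightarrow>
     D \<in> symfuns \<rightarrow> symfuns \<and>
     (\<forall>f\<in>symfuns. \<forall>g\<in>symfuns. D (f + g) = D f + D g) \<and>
     (\<forall>c. \<forall>f\<in>symfuns. D (smult c f) = smult c (D f)) \<and>
     (\<forall>f\<in>symfuns. \<forall>g\<in>symfuns. D (f * g) = D f * g + f * D g) \<and>
     (\<forall>n>0. D (hsym n) = smult (of_nat n + q - 1) (hsym (n - 1)))"


section \<open>Partitions and skew Schur functions\<close>

text \<open>
  Sequences are indexed from \<open>0\<close>: \<open>lookup \<lambda> i\<close> is \<open>\<lambda>\<^bsub>i+1\<^esub>\<close>.  The entries are integers, so that
  \<open>\<lambda> - e\<^sub>i\<close> is formed without truncation: it has the entry \<open>-1\<close>, and is not a partition, if the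
  \<open>i\<close>-th entry of \<open>\<lambda>\<close> is \<open>0\<close>.
\<close>

definition is_partition :: "(nat \<Rightarrow>\<^sub>0 int) \<Rightarrow> bool" where
  "is_partition lam \<longleftrightarrow> (\<forall>i. 0 \<le> lookup lam i) \<and> (\<forall>i j. i \<le> j \<longrightarrow> lookup lam j \<le> lookup lam i)"

abbreviation unit_seq :: "nat \<Rightarrow> (nat \<Rightarrow>\<^sub>0 int)" where
  "unit_seq i \<equiv> Poly_Mapping.single i 1"

definition skew_diagram :: "(nat \<Rightarrow>\<^sub>0 int) \<Rightarrow> (nat \<Rightarrow>\<^sub>0 int) \<Rightarrow> (nat \<times> nat) set" where
  "skew_diagram lam mu = {(i, j). lookup mu i \<le> int j \<and> int j < lookup lam i}"

text \<open>
  Semistandard tableaux: rows weakly increase from left to right, columns strictly increase from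
  top to bottom.  The entry \<open>v\<close> stands for the variable with index \<open>v\<close>.
\<close>

definition ssyts :: "(nat \<Rightarrow>\<^sub>0 int) \<Rightarrow> (nat \<Rightarrow>\<^sub>0 int) \<Rightarrow> (nat \<times> nat \<Rightarrow> nat) set" where
  "ssyts lam mu = {T \<in> extensional (skew_diagram lam mu).
     (\<forall>i j j'. (i, j) \<in> skew_diagram lam mu \<and> (i, j') \<in> skew_diagram lam mu \<and> j < j' \<longrightarrow> T (i, j) \<le> T (i, j')) \<and>
     (\<forall>i i' j. (i, j) \<in> skew_diagram lam mu \<and> (i', j) \<in> skew_diagram lam mu \<and> i < i' \<longrightarrow> T (i, j) < T (i', j))}"

text \<open>The exponent vector of \<open>x\<^sub>T\<close>, the product over all cells \<open>c\<close> of the variables \<open>x\<^bsub>T(c)\<^esub>\<close>.\<close>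

definition tableau_monomial ::
    "(nat \<Rightarrow>\<^sub>0 int) \<Rightarrow> (nat \<Rightarrow>\<^sub>0 int) \<Rightarrow> (nat \<times> nat \<Rightarrow> nat) \<Rightarrow> monomial" where
  "tableau_monomial lam mu T = (\<Sum>c\<in>skew_diagram lam mu. Poly_Mapping.single (T c) 1)"

text \<open>
  \<open>s\<^bsub>\<lambda>/\<mu>\<^esub>\<close> is the sum of \<open>x\<^sub>T\<close> over all semistandard tableaux \<open>T\<close>, given by its coefficients; only
  finitely many tableaux contribute to each of them (see \<open>finite_ssyts_of_content\<close> below).
\<close>

lift_definition skew_schur :: "(nat \<Rightarrow>\<^sub>0 int) \<Rightarrow> (nat \<Rightarrow>\<^sub>0 int) \<Rightarrow> 'k :: comm_ring_1 mfps"
  is "\<lambda>lam mu m. if \<forall>i. lookup mu i \<le> lookup lam i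
               then of_nat (card {T \<in> ssyts lam mu. tableau_monomial lam mu T = m}) else 0" .


section \<open>Finiteness\<close>

lemma finite_skew_diagram:
  assumes "is_partition lam" "is_partition mu"
  shows "finite (skew_diagram lam mu)"
proof (rule finite_subset)
  show "skew_diagram lam mu \<subseteq> keys lam \<times> {..<nat (lookup lam 0)}"
  proof (rule subrelI)
    fix i j assume "(i, j) \<in> skew_diagram lam mu"
    then have "int j < lookup lam i"
      by (simp add: skew_diagram_def)
    moreover have "lookup lam i \<le> lookup lam 0"
      using assms by (simp add: is_partition_def)
    ultimately show "(i, j) \<in> keys lam \<times> {..<nat (lookup lam 0)}"
      by (auto simp: in_keys_iff)
  qed
qed auto

lemma finite_ssyts_of_content:
  assumes "is_partition lam" "is_partition mu"
  shows "finite {T \<in> ssyts lam mu. tableau_monomial lam mu T = m}"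
proof (rule finite_subset)
  note fin = finite_skew_diagram[OF assms]
  show "{T \<in> ssyts lam mu. tableau_monomial lam mu T = m} \<subseteq> skew_diagram lam mu \<rightarrow>\<^sub>E keys m"
  proof
    fix T assume "T \<in> {T \<in> ssyts lam mu. tableau_monomial lam mu T = m}"
    then have T: "T \<in> ssyts lam mu" and m: "tableau_monomial lam mu T = m"
      by auto
    have "T c \<in> keys (tableau_monomial lam mu T)" if "c \<in> skew_diagram lam mu" for c
      using fin that
      by (auto simp: in_keys_iff tableau_monomial_def lookup_sum lookup_single when_def)
    then show "T \<in> skew_diagram lam mu \<rightarrow>\<^sub>E keys m"
      using T m by (auto simp: PiE_def ssyts_def)
  qed
  show "finite (skew_diagram lam mu \<rightarrow>\<^sub>E keys m)"
    using fin by (intro finite_PiE) auto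
qed

lemma finite_removable: "finite {i. is_partition (lam - unit_seq i)}"
proof (rule finite_subset)
  show "{i. is_partition (lam - unit_seq i)} \<subseteq> keys lam"
  proof
    fix i assume "i \<in> {i. is_partition (lam - unit_seq i)}"
    then have "0 \<le> lookup (lam - unit_seq i) i"
      by (simp add: is_partition_def)
    then show "i \<in> keys lam"
      by (simp add: in_keys_iff lookup_minus)
  qed
qed auto

lemma finite_addable: "finite {i. is_partition (mu + unit_seq i)}"
proof (rule finite_subset)
  show "{i. is_partition (mu + unit_seq i)} \<subseteq> insert 0 (Suc ` keys mu \<union> keys mu)"
  proof (rule subsetI, rule ccontr)
    fix i assume "i \<in> {i. is_partition (mu + unit_seq i)}" "i \<notin> insert 0 (Suc ` keys mu \<union> keys mu)"
    then have *: "is_partition (mu + unit_seq i)" "i \<notin> Suc ` keys mu" "i \<notin> keys mu" "i \<noteq> 0"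
      by auto
    then obtain j where j: "i = Suc j"
      using not0_implies_Suc by blast
    have "lookup (mu + unit_seq i) i \<le> lookup (mu + unit_seq i) j"
      using *(1) j by (simp add: is_partition_def)
    moreover have "lookup mu j = 0"
      using * j by (auto simp: in_keys_iff)
    ultimately show False
      using * j by (auto simp: in_keys_iff lookup_add lookup_single)
  qed
qed auto

end

theory Submission
  imports Defs "Jordan_Normal_Form.Determinant"
begin

text \<open>
  By the Jacobi-Trudi formula \<open>s\<^bsub>\<lambda>/\<mu>\<^esub> = det (h(\<lambda>\<^sub>i - i - \<mu>\<^sub>j + j))\<close>.  The derivation multiplies the
  \<open>(i, j)\<close> entry by \<open>\<ell>\<^sub>i - m\<^sub>j + q - 1 = (\<ell>\<^sub>i + a) + (b - m\<^sub>j)\<close> and lowers its index by one.  The first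
  summand depends on the row only and the second on the column only, so Leibniz' rule gives a sum over
  rows, in which \<open>\<lambda>\<close> is replaced by \<open>\<lambda> - e\<^sub>i\<close>, and a sum over columns, in which \<open>\<mu>\<close> is replaced by
  \<open>\<mu> + e\<^sub>j\<close>.  If the new sequence is not a partition, the determinant has two equal rows or columns
  or a zero row.

  The Jacobi-Trudi formula is proved for \<open>N\<close> variables by induction on \<open>N\<close>.  Removing the cells with
  the largest entry from a tableau removes a horizontal strip.  On the determinant side, subtracting
  from each row a multiple of the next one turns row \<open>i\<close> into a sum over the possible lengths
  \<open>\<lambda>\<^bsub>i+1\<^esub> \<le> \<nu>\<^sub>i \<le> \<lambda>\<^sub>i\<close> of the remaining row, and multilinearity yields the same recursion.
\<close>

hide_const (open) Polynomial.coeff Polynomial.smult Module.module.smult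

section \<open>The algebra of symmetric functions\<close>

lemma coeff_times: "coeff (f * g) m = (\<Sum>(a, b)\<in>{(a, b). a + b = m}. coeff f a * coeff g b)"
  by (simp add: times_mfps.rep_eq)

lemma coeff_sum: "coeff (\<Sum>i\<in>A. f i) m = (\<Sum>i\<in>A. coeff (f i) m)"
  by (induction A rule: infinite_finite_induct) (auto simp: zero_mfps.rep_eq plus_mfps.rep_eq)

lemma smult_mult_left: "smult c f * g = smult c (f * g)"
  by (rule mfps_eqI) (simp add: Defs.smult.rep_eq coeff_times sum_distrib_left case_prod_unfold mult.assoc)

lemma smult_mult_right: "f * smult c g = smult c (f * g)"
  by (metis mult.commute smult_mult_left)

lemma smult_zero_right [simp]: "smult c 0 = 0"
  by (rule mfps_eqI) (simp add: Defs.smult.rep_eq zero_mfps.rep_eq)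

lemma smult_zero_left [simp]: "smult 0 f = 0"
  by (rule mfps_eqI) (simp add: Defs.smult.rep_eq zero_mfps.rep_eq)

lemma smult_one_left [simp]: "smult 1 f = f"
  by (rule mfps_eqI) (simp add: Defs.smult.rep_eq)

lemma smult_minus_left: "smult (- c) f = - smult c f"
  by (rule mfps_eqI) (simp add: Defs.smult.rep_eq uminus_mfps.rep_eq)

lemma smult_add_left: "smult (c + d) f = smult c f + smult d f"
  by (rule mfps_eqI) (simp add: Defs.smult.rep_eq plus_mfps.rep_eq algebra_simps)

lemma smult_smult: "smult c (smult d f) = smult (c * d) f"
  by (rule mfps_eqI) (simp add: Defs.smult.rep_eq mult.assoc)

lemma smult_sum_right: "smult c (\<Sum>i\<in>A. f i) = (\<Sum>i\<in>A. smult c (f i))"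
  by (rule mfps_eqI) (simp add: Defs.smult.rep_eq coeff_sum sum_distrib_left)

text \<open>Turns the signs of the Leibniz formula, which are elements of the power series ring,
  into scalars, so that linearity of the derivation applies to each term.\<close>

lemma signof_mult_eq_smult: "(signof p :: 'k :: comm_ring_1 mfps) * f = smult (signof p) f"
  by (simp add: sign_def smult_minus_left)

section \<open>Degrees, renaming of variables, and closure properties of
  \<open>symfuns\<close>\<close>

lemma mon_degree_superset:
  assumes "finite A" "keys m \<subseteq> A"
  shows "mon_degree m = (\<Sum>i\<in>A. lookup m i)"
  unfolding mon_degree_def by (rule sum.mono_neutral_left) (use assms in \<open>auto simp: in_keys_iff\<close>)

lemma mon_degree_add: "mon_degree (a + b) = mon_degree a + mon_degree b"
proof -
  let ?A = "keys a \<union> keys b"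
  have "keys (a + b) \<subseteq> ?A" by (simp add: Poly_Mapping.keys_add)
  then show ?thesis
    by (simp add: mon_degree_superset[of ?A] lookup_add sum.distrib)
qed

lemma mon_degree_single [simp]: "mon_degree (Poly_Mapping.single i n) = n"
  by (simp add: mon_degree_def)

lemma mon_degree_map_key:
  assumes "bij \<pi>"
  shows "mon_degree (Poly_Mapping.map_key \<pi> m) = mon_degree m"
proof -
  have inj: "inj \<pi>" using assms by (rule bij_is_inj)
  have "bij_betw \<pi> (\<pi> -` keys m) (keys m)"
    using assms by (metis bij_betw_def inj inj_on_subset subset_UNIV surj_image_vimage_eq)
  then show ?thesis
    unfolding mon_degree_def keys_map_key[OF inj] map_key.rep_eq[OF inj] o_def
    by (rule sum.reindex_bij_betw)
qed

lemma map_key_inv: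
  assumes "bij \<pi>"
  shows "Poly_Mapping.map_key \<pi> (Poly_Mapping.map_key (inv_into UNIV \<pi>) m) = m"
    and "Poly_Mapping.map_key (inv_into UNIV \<pi>) (Poly_Mapping.map_key \<pi> m) = m"
  using assms
  by (auto intro!: poly_mapping_eqI simp: map_key.rep_eq bij_is_inj bij_imp_bij_inv bij_is_surj surj_f_inv_f)

lemma symfunsI:
  assumes "\<And>\<pi> m. bij \<pi> \<Longrightarrow> coeff f (Poly_Mapping.map_key \<pi> m) = coeff f m"
    and "\<And>m. coeff f m \<noteq> 0 \<Longrightarrow> mon_degree m \<le> d"
  shows "f \<in> symfuns"
  using assms unfolding symfuns_def by blast

lemma symfuns_coeff_map_key:
  "f \<in> symfuns \<Longrightarrow> bij \<pi> \<Longrightarrow> coeff f (Poly_Mapping.map_key \<pi> m) = coeff f m"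
  unfolding symfuns_def by blast

lemma symfuns_degree_bound:
  assumes "f \<in> symfuns"
  obtains d where "\<And>m. coeff f m \<noteq> 0 \<Longrightarrow> mon_degree m \<le> d"
  using assms unfolding symfuns_def by blast

lemma hsym_symfuns: "hsym n \<in> symfuns"
  by (rule symfunsI[where d = n]) (auto simp: hsym.rep_eq mon_degree_map_key split: if_splits)

lemma zero_symfuns: "0 \<in> symfuns"
  by (rule symfunsI[where d = 0]) (auto simp: zero_mfps.rep_eq)

lemma hsym_0: "hsym 0 = 1"
proof (rule mfps_eqI)
  fix m
  have "mon_degree m = 0 \<longleftrightarrow> m = 0"
    by (auto simp: mon_degree_def in_keys_iff intro!: poly_mapping_eqI)
  then show "coeff (hsym 0) m = coeff 1 m"
    by (simp add: hsym.rep_eq one_mfps.rep_eq)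
qed

lemma one_symfuns: "1 \<in> symfuns"
  using hsym_symfuns[of 0] by (simp add: hsym_0)

lemma smult_symfuns:
  assumes "f \<in> symfuns"
  shows "smult c f \<in> symfuns"
proof -
  obtain d where d: "\<And>m. coeff f m \<noteq> 0 \<Longrightarrow> mon_degree m \<le> d"
    using symfuns_degree_bound[OF assms] by blast
  show ?thesis
    by (rule symfunsI[where d = d]) (use assms in \<open>auto simp: Defs.smult.rep_eq symfuns_coeff_map_key intro!: d dest: mult_not_zero\<close>)
qed

lemma add_symfuns:
  assumes "f \<in> symfuns" "g \<in> symfuns"
  shows "f + g \<in> symfuns"
proof -
  obtain d where d: "\<And>m. coeff f m \<noteq> 0 \<Longrightarrow> mon_degree m \<le> d"
    using symfuns_degree_bound[OF assms(1)] by blast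
  obtain e where e: "\<And>m. coeff g m \<noteq> 0 \<Longrightarrow> mon_degree m \<le> e"
    using symfuns_degree_bound[OF assms(2)] by blast
  have "mon_degree m \<le> d + e" if "coeff (f + g) m \<noteq> 0" for m
  proof -
    have "coeff f m \<noteq> 0 \<or> coeff g m \<noteq> 0"
      using that by (auto simp: plus_mfps.rep_eq)
    then show ?thesis
      using d[of m] e[of m] by linarith
  qed
  then show ?thesis
    by (intro symfunsI[where d = "d + e"]) (use assms in \<open>auto simp: plus_mfps.rep_eq symfuns_coeff_map_key\<close>)
qed

text \<open>Degree bounds add up, and renaming the variables carries the splittings of
  \<open>m\<close> bijectively to those of the renamed monomial.\<close>

lemma mult_symfuns:
  assumes "f \<in> symfuns" "g \<in> symfuns"
  shows "f * g \<in> symfuns"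
proof -
  obtain d where d: "\<And>m. coeff f m \<noteq> 0 \<Longrightarrow> mon_degree m \<le> d"
    using symfuns_degree_bound[OF assms(1)] by blast
  obtain e where e: "\<And>m. coeff g m \<noteq> 0 \<Longrightarrow> mon_degree m \<le> e"
    using symfuns_degree_bound[OF assms(2)] by blast
  have "mon_degree m \<le> d + e" if nz: "coeff (f * g) m \<noteq> 0" for m
  proof -
    obtain x where "x \<in> {(a, b). a + b = m}" and "(case x of (a, b) \<Rightarrow> coeff f a * coeff g b) \<noteq> 0"
      using nz unfolding coeff_times by (rule sum.not_neutral_contains_not_neutral)
    then obtain a b where ab: "a + b = m" "coeff f a * coeff g b \<noteq> 0"
      by auto
    then have "coeff f a \<noteq> 0" "coeff g b \<noteq> 0"
      by auto
    then show ?thesis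
      using d[of a] e[of b] by (simp flip: ab(1) add: mon_degree_add)
  qed
  moreover have "coeff (f * g) (Poly_Mapping.map_key \<pi> m) = coeff (f * g) m" if \<pi>: "bij \<pi>" for \<pi> m
  proof -
    let ?k = "Poly_Mapping.map_key \<pi>" and ?k' = "Poly_Mapping.map_key (inv_into UNIV \<pi>)"
    have inj: "inj \<pi>" "inj (inv_into UNIV \<pi>)"
      using \<pi> by (simp_all add: bij_is_inj bij_imp_bij_inv)
    show ?thesis
      unfolding coeff_times
      by (rule sum.reindex_bij_witness[of _ "\<lambda>(a, b). (?k a, ?k b)" "\<lambda>(a, b). (?k' a, ?k' b)"])
        (use \<pi> inj assms in \<open>auto simp: map_key_inv symfuns_coeff_map_key bij_imp_bij_inv simp flip: map_key_plus\<close>)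
  qed
  ultimately show ?thesis
    by (intro symfunsI[where d = "d + e"]) auto
qed

lemma sum_symfuns: "(\<And>i. i \<in> A \<Longrightarrow> f i \<in> symfuns) \<Longrightarrow> (\<Sum>i\<in>A. f i) \<in> symfuns"
  by (induction A rule: infinite_finite_induct) (auto simp: zero_symfuns add_symfuns)

lemma prod_symfuns: "(\<And>i. i \<in> A \<Longrightarrow> f i \<in> symfuns) \<Longrightarrow> (\<Prod>i\<in>A. f i) \<in> symfuns"
  by (induction A rule: infinite_finite_induct) (auto simp: one_symfuns mult_symfuns)

section \<open>The derivation on constants, finite sums and finite products\<close>

context
  fixes q :: "'k :: comm_ring_1" and D :: "'k mfps \<Rightarrow> 'k mfps"
  assumes D: "is_nabla q D"
begin

lemma nabla_add: "f \<in> symfuns \<Longrightarrow> g \<in> symfuns \<Longrightarrow> D (f + g) = D f + D g"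
  and nabla_smult: "f \<in> symfuns \<Longrightarrow> D (smult c f) = smult c (D f)"
  and nabla_mult: "f \<in> symfuns \<Longrightarrow> g \<in> symfuns \<Longrightarrow> D (f * g) = D f * g + f * D g"
  and nabla_hsym: "n > 0 \<Longrightarrow> D (hsym n) = smult (of_nat n + q - 1) (hsym (n - 1))"
  using D unfolding is_nabla_def by blast+

lemma nabla_0: "D 0 = 0"
  using nabla_smult[OF zero_symfuns, of 0] by simp

lemma nabla_1: "D 1 = 0"
  using nabla_mult[OF one_symfuns one_symfuns] by simp

lemma nabla_sum: "(\<And>i. i \<in> A \<Longrightarrow> f i \<in> symfuns) \<Longrightarrow> D (\<Sum>i\<in>A. f i) = (\<Sum>i\<in>A. D (f i))"
  by (induction A rule: infinite_finite_induct) (auto simp: nabla_0 nabla_add sum_symfuns)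

lemma nabla_prod:
  assumes "finite A" "\<And>i. i \<in> A \<Longrightarrow> f i \<in> symfuns"
  shows "D (\<Prod>i\<in>A. f i) = (\<Sum>i\<in>A. D (f i) * (\<Prod>j\<in>A - {i}. f j))"
  using assms
proof (induction A rule: finite_induct)
  case empty
  then show ?case by (simp add: nabla_1)
next
  case (insert x A)
  have "(\<Prod>j\<in>insert x A - {i}. f j) = f x * (\<Prod>j\<in>A - {i}. f j)" if "i \<in> A" for i
    using insert.hyps that by (subst insert_Diff_if) auto
  moreover have "insert x A - {x} = A"
    using insert.hyps by auto
  ultimately show ?case
    using insert by (simp add: nabla_mult prod_symfuns sum_distrib_left mult_ac)
qed

end

section \<open>Determinants of complete homogeneous symmetric functions\<close>

definition hsym_int :: "int \<Rightarrow> 'k :: comm_ring_1 mfps" where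
  "hsym_int k = (if k < 0 then 0 else hsym (nat k))"

lemma hsym_int_symfuns: "hsym_int k \<in> symfuns"
  by (simp add: hsym_int_def hsym_symfuns zero_symfuns)

text \<open>The defining rule of \<open>is_nabla\<close> covers \<open>k > 0\<close> only. For
  \<open>k \<le> 0\<close> both sides vanish, since \<open>hsym_int k\<close> is \<open>0\<close> or
  \<open>1\<close> and \<open>hsym_int (k - 1)\<close> is \<open>0\<close>.\<close>

lemma nabla_hsym_int:
  assumes D: "is_nabla q D"
  shows "D (hsym_int k) = smult (of_int k + q - 1) (hsym_int (k - 1))"
proof (cases "k > 0")
  case True
  then have "nat (k - 1) = nat k - 1" "(of_nat (nat k) :: 'a) = of_int k"
    by auto
  then show ?thesis
    using True nabla_hsym[OF D, of "nat k"] by (simp add: hsym_int_def)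
next
  case False
  then show ?thesis
    by (cases "k = 0") (auto simp: hsym_int_def hsym_0 nabla_0[OF D] nabla_1[OF D])
qed

text \<open>Shifted parts such as \<open>lookup lam i - int i\<close> are passed as \<open>r\<close>
  and \<open>c\<close>, so that changing one part is a function update. The parameter
  \<open>h\<close> lets full and truncated complete functions share one determinant.\<close>

definition hdet :: "(int \<Rightarrow> 'r :: comm_ring_1) \<Rightarrow> nat \<Rightarrow> (nat \<Rightarrow> int) \<Rightarrow> (nat \<Rightarrow> int) \<Rightarrow> 'r" where
  "hdet h n r c = det (mat n n (\<lambda>(i, j). h (r i - c j)))"

lemma hdet_expand:
  "hdet h n r c = (\<Sum>p\<in>{p. p permutes {0..<n}}. signof p * (\<Prod>i=0..<n. h (r i - c (p i))))"
  unfolding hdet_def det_def'[of _ n, simplified]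
  by (subst det_def'[of _ n]) (auto intro!: sum.cong prod.cong simp: permutes_in_image)

lemma nabla_hdet:
  fixes q :: "'k :: comm_ring_1"
  assumes D: "is_nabla q D" and ab: "a + b = q - 1"
  shows "D (hdet hsym_int n r c) =
      (\<Sum>i<n. smult (of_int (r i) + a) (hdet hsym_int n (r(i := r i - 1)) c))
    + (\<Sum>j<n. smult (b - of_int (c j)) (hdet hsym_int n r (c(j := c j + 1))))"
proof -
  let ?P = "{p. p permutes {0..<n}}"
  \<comment> \<open>The contribution of row \<open>i\<close> to the derivative of the term for
    \<open>p\<close>, without its sign and its scalar coefficient.\<close>
  let ?t = "\<lambda>p i. (hsym_int :: int \<Rightarrow> 'k mfps) (r i - c (p i) - 1) * (\<Prod>j\<in>{0..<n} - {i}. hsym_int (r j - c (p j)))"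
  have split_off: "(\<Prod>j\<in>{0..<n}. f j) = f i * (\<Prod>j\<in>{0..<n} - {i}. f j)" if "i < n" for i and f :: "nat \<Rightarrow> 'k mfps"
    using that by (intro prod.remove) auto
  have row: "?t p i = (\<Prod>j=0..<n. hsym_int ((r(i := r i - 1)) j - c (p j)))" if "i < n" for p i
    by (subst split_off[OF that]) (auto intro!: arg_cong2[of _ _ _ _ "(*)"] prod.cong simp: algebra_simps)
  \<comment> \<open>A permutation meets column \<open>p i\<close> in row \<open>i\<close> only, so
    raising \<open>c\<close> at \<open>p i\<close> lowers exactly the differentiated factor.\<close>
  have col: "?t p i = (\<Prod>j=0..<n. hsym_int (r j - (c(p i := c (p i) + 1)) (p j)))" if "i < n" "p \<in> ?P" for p i
  proof -
    have "p j \<noteq> p i" if "j \<noteq> i" for j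
      using \<open>p \<in> ?P\<close> that by (auto dest: permutes_inj simp: inj_eq)
    then show ?thesis
      by (subst split_off[OF that(1)]) (auto intro!: arg_cong2[of _ _ _ _ "(*)"] prod.cong simp: algebra_simps)
  qed
  have nabla_coeff: "of_int (x - y) + q - 1 = (of_int x + a) + (b - of_int y)" for x y
    using ab by (simp add: algebra_simps)
  have "D (hdet hsym_int n r c) = (\<Sum>p\<in>?P. smult (signof p) (\<Sum>i=0..<n. smult (of_int (r i - c (p i)) + q - 1) (?t p i)))"
    unfolding hdet_expand signof_mult_eq_smult
    by (simp add: nabla_sum[OF D] nabla_smult[OF D] nabla_prod[OF D] nabla_hsym_int[OF D] smult_symfuns prod_symfuns
        hsym_int_symfuns smult_mult_left smult_mult_right algebra_simps)
  also have "\<dots> = (\<Sum>p\<in>?P. \<Sum>i=0..<n. smult (signof p * (of_int (r i) + a)) (?t p i))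
      + (\<Sum>p\<in>?P. \<Sum>i=0..<n. smult (signof p * (b - of_int (c (p i)))) (?t p i))"
    by (simp only: smult_sum_right smult_smult nabla_coeff flip: distrib_left smult_add_left sum.distrib)
  also have "(\<Sum>p\<in>?P. \<Sum>i=0..<n. smult (signof p * (of_int (r i) + a)) (?t p i))
      = (\<Sum>i<n. smult (of_int (r i) + a) (hdet hsym_int n (r(i := r i - 1)) c))"
    by (subst sum.swap)
      (simp add: row hdet_expand signof_mult_eq_smult smult_sum_right smult_smult mult_ac lessThan_atLeast0)
  also have "(\<Sum>p\<in>?P. \<Sum>i=0..<n. smult (signof p * (b - of_int (c (p i)))) (?t p i))
      = (\<Sum>j<n. smult (b - of_int (c j)) (hdet hsym_int n r (c(j := c j + 1))))"
  proof -
    \<comment> \<open>Indexing by the column \<open>j = p i\<close> instead of the row makes the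
      coefficient independent of \<open>p\<close> up to sign, so that the sum over \<open>p\<close>
      is again a determinant.\<close>
    let ?g = "\<lambda>p j. smult (signof p * (b - of_int (c j))) (\<Prod>k=0..<n. hsym_int (r k - (c(j := c j + 1)) (p k)))"
    have "(\<Sum>i=0..<n. smult (signof p * (b - of_int (c (p i)))) (?t p i)) = (\<Sum>j=0..<n. ?g p j)" if p: "p \<in> ?P" for p
    proof -
      have "(\<Sum>i=0..<n. smult (signof p * (b - of_int (c (p i)))) (?t p i)) = (\<Sum>i=0..<n. ?g p (p i))"
        using col[OF _ p] by (intro sum.cong) auto
      also have "\<dots> = (\<Sum>j=0..<n. ?g p j)"
        using p by (intro sum.reindex_bij_betw) (auto intro: permutes_imp_bij)
      finally show ?thesis .
    qed
    then have "(\<Sum>p\<in>?P. \<Sum>i=0..<n. smult (signof p * (b - of_int (c (p i)))) (?t p i)) = (\<Sum>p\<in>?P. \<Sum>j=0..<n. ?g p j)"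
      by (rule sum.cong[OF refl])
    also have "\<dots> = (\<Sum>j=0..<n. \<Sum>p\<in>?P. ?g p j)"
      by (rule sum.swap)
    finally show ?thesis
      by (simp add: hdet_expand signof_mult_eq_smult smult_sum_right smult_smult mult_ac lessThan_atLeast0)
  qed
  finally show ?thesis .
qed

lemma hdet_eq_rows:
  assumes "i < n" "j < n" "i \<noteq> j" "r i = r j"
  shows "hdet h n r c = 0"
  unfolding hdet_def
  by (rule det_identical_rows[of _ n i j]) (use assms in auto)

lemma hdet_eq_cols:
  assumes "i < n" "j < n" "i \<noteq> j" "c i = c j"
  shows "hdet h n r c = 0"
  unfolding hdet_def
  by (rule det_identical_columns[of _ n i j]) (use assms in auto)

section \<open>Restriction to finitely many variables\<close>

text \<open>Substitution of \<open>0\<close> for all variables with index at least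
  \<open>N\<close>.\<close>

lift_definition trunc :: "nat \<Rightarrow> 'k :: comm_ring_1 mfps \<Rightarrow> 'k mfps"
  is "\<lambda>N f m. if keys m \<subseteq> {..<N} then f m else 0" .

definition mono_mfps :: "monomial \<Rightarrow> 'k :: comm_ring_1 mfps" where
  "mono_mfps u = Abs_mfps (\<lambda>m. if m = u then 1 else 0)"

lemma coeff_mono: "coeff (mono_mfps u) m = (if m = u then 1 else 0)"
  by (simp add: mono_mfps_def Abs_mfps_inverse)

lemma keys_add_nat: "keys (a + b) = keys a \<union> keys (b :: monomial)"
  by (auto simp: in_keys_iff lookup_add)

text \<open>Exponents are natural numbers, so nothing cancels in \<open>a + b\<close>: the product
  of two monomials uses only the first \<open>N\<close> variables iff both factors do.\<close>

lemma comm_ring_hom_trunc: "comm_ring_hom (trunc N :: 'k :: comm_ring_1 mfps \<Rightarrow> 'k mfps)"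
proof
  show "trunc N (f * g) = trunc N f * trunc N g" for f g :: "'k mfps"
  proof (rule mfps_eqI)
    fix m
    show "coeff (trunc N (f * g)) m = coeff (trunc N f * trunc N g) m"
    proof (cases "keys m \<subseteq> {..<N}")
      case True
      then show ?thesis
        by (auto simp: trunc.rep_eq coeff_times keys_add_nat intro!: sum.cong)
    next
      case False
      then have "coeff (trunc N f * trunc N g) m = 0"
        unfolding coeff_times by (intro sum.neutral) (auto simp: trunc.rep_eq keys_add_nat)
      with False show ?thesis
        by (simp add: trunc.rep_eq)
    qed
  qed
qed (auto intro!: mfps_eqI simp: trunc.rep_eq plus_mfps.rep_eq one_mfps.rep_eq zero_mfps.rep_eq)

lemma hdet_hom:
  assumes "comm_ring_hom \<phi>"
  shows "\<phi> (hdet h n r c) = hdet (\<lambda>k. \<phi> (h k)) n r c"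
proof -
  interpret comm_ring_hom \<phi> by (rule assms)
  show ?thesis
    unfolding hdet_def hom_det[symmetric] by (intro arg_cong[of _ _ det]) auto
qed

text \<open>By cancellation the index set has at most one element; it is empty if the monomial
  \<open>u\<close> does not divide \<open>m\<close>.\<close>

lemma coeff_mono_times: "coeff (mono_mfps u * f) m = (\<Sum>v\<in>{v. u + v = m}. coeff f v)"
proof -
  have "coeff (mono_mfps u * f) m = (\<Sum>p\<in>{(a, b). a + b = m}. if fst p = u then coeff f (snd p) else 0)"
    unfolding coeff_times by (intro sum.cong) (auto simp: coeff_mono)
  also have "\<dots> = (\<Sum>p\<in>{p \<in> {(a, b). a + b = m}. fst p = u}. coeff f (snd p))"
    by (subst sum.inter_filter[symmetric]) auto
  also have "\<dots> = (\<Sum>v\<in>{v. u + v = m}. coeff f v)"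
    by (rule sum.reindex_bij_witness[of _ "\<lambda>v. (u, v)" snd]) auto
  finally show ?thesis .
qed

lemma mono_mfps_add: "mono_mfps (u + v) = mono_mfps u * mono_mfps v"
proof (rule mfps_eqI)
  fix m
  show "coeff (mono_mfps (u + v)) m = coeff (mono_mfps u * mono_mfps v) m"
  proof (cases "m = u + v")
    case True
    then have "{w. u + w = m} = {v}" by auto
    with True show ?thesis by (simp add: coeff_mono_times coeff_mono)
  next
    case False
    then show ?thesis by (auto simp: coeff_mono_times coeff_mono intro!: sum.neutral)
  qed
qed

lemma mono_mfps_0: "mono_mfps 0 = 1"
  by (rule mfps_eqI) (auto simp: coeff_mono one_mfps.rep_eq)

abbreviation var :: "nat \<Rightarrow> 'k :: comm_ring_1 mfps" where
  "var N \<equiv> mono_mfps (Poly_Mapping.single N (Suc 0))"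

lemma var_power: "var N ^ d = mono_mfps (Poly_Mapping.single N d)"
proof (induction d)
  case (Suc d)
  have "Poly_Mapping.single N (Suc d) = Poly_Mapping.single N (Suc 0) + Poly_Mapping.single N d"
    by (simp flip: single_add)
  with Suc show ?case
    by (simp only: mono_mfps_add power_Suc)
qed (simp add: mono_mfps_0)

section \<open>Complete homogeneous polynomials in \<open>N\<close> variables and their
  determinants\<close>

definition hsym_trunc :: "nat \<Rightarrow> int \<Rightarrow> 'k :: comm_ring_1 mfps" where
  "hsym_trunc N k = trunc N (hsym_int k)"

lemma hsym_trunc_nonpos: "k \<le> 0 \<Longrightarrow> hsym_trunc N k = (if k = 0 then 1 else 0)"
  by (auto intro!: mfps_eqI simp: hsym_trunc_def hsym_int_def hsym_0 trunc.rep_eq one_mfps.rep_eq zero_mfps.rep_eq)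

lemma coeff_hsym_trunc: "coeff (hsym_trunc N k) m = (if keys m \<subseteq> {..<N} \<and> int (mon_degree m) = k then 1 else 0)"
  by (auto simp: hsym_trunc_def hsym_int_def trunc.rep_eq hsym.rep_eq zero_mfps.rep_eq)

text \<open>A monomial in the first \<open>N + 1\<close> variables either omits \<open>var N\<close>
  or is \<open>var N\<close> times another such monomial.\<close>

lemma hsym_trunc_Suc: "hsym_trunc (Suc N) k = hsym_trunc N k + var N * hsym_trunc (Suc N) (k - 1)"
proof (rule mfps_eqI)
  fix m :: monomial
  let ?e = "Poly_Mapping.single N (Suc 0)"
  show "coeff (hsym_trunc (Suc N) k) m = coeff (hsym_trunc N k + var N * hsym_trunc (Suc N) (k - 1) :: 'a mfps) m"
  proof (cases "lookup m N = 0")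
    case True
    then have "keys m \<subseteq> {..<Suc N} \<longleftrightarrow> keys m \<subseteq> {..<N}"
      by (auto simp: in_keys_iff less_Suc_eq subset_iff) (metis less_irrefl)
    moreover have "{v. ?e + v = m} = {}"
      using True by (auto simp: lookup_add)
    ultimately show ?thesis
      by (simp add: coeff_hsym_trunc coeff_mono_times plus_mfps.rep_eq)
  next
    case False
    define v where "v = m - ?e"
    have m: "m = ?e + v"
      using False by (auto simp: v_def lookup_add lookup_minus lookup_single when_def intro!: poly_mapping_eqI)
    have "{w. ?e + w = m} = {v}"
      using m by auto
    moreover have "\<not> keys m \<subseteq> {..<N}"
      using False by (auto simp: in_keys_iff subset_iff)
    ultimately show ?thesis
      by (simp add: coeff_hsym_trunc coeff_mono_times plus_mfps.rep_eq)
        (auto simp: m keys_add_nat mon_degree_add)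
  qed
qed

text \<open>Telescopes \<open>d\<close> applications of the recursion
  \<open>hsym_trunc_Suc\<close>.\<close>

lemma hsym_trunc_Suc_iterate:
  "hsym_trunc (Suc N) k - var N ^ d * hsym_trunc (Suc N) (k - int d) = (\<Sum>t<d. var N ^ t * hsym_trunc N (k - int t))"
proof (induction d)
  case (Suc d)
  let ?x = "var N :: 'a mfps"
  have step: "hsym_trunc (Suc N) (k - int d) = hsym_trunc N (k - int d) + ?x * hsym_trunc (Suc N) (k - int (Suc d))"
    by (subst hsym_trunc_Suc) (simp add: algebra_simps)
  have "(\<Sum>t<Suc d. ?x ^ t * hsym_trunc N (k - int t)) = hsym_trunc (Suc N) k - ?x ^ d * hsym_trunc (Suc N) (k - int d) + ?x ^ d * hsym_trunc N (k - int d)"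
    using Suc by simp
  also have "\<dots> = hsym_trunc (Suc N) k - ?x ^ Suc d * hsym_trunc (Suc N) (k - int (Suc d))"
    unfolding step power_Suc by (simp only: algebra_simps)
  finally show ?case ..
qed simp

text \<open>With \<open>hi\<close> and \<open>lo\<close> the lengths of rows \<open>i\<close> and
  \<open>i + 1\<close>, the left side is an entry of row \<open>i\<close> after a multiple of row
  \<open>i + 1\<close> is subtracted. The \<open>- 1\<close> comes from the shift by the row
  number.\<close>

lemma hsym_trunc_Suc_interval:
  assumes "lo \<le> hi"
  shows "hsym_trunc (Suc N) (hi - k) - var N ^ Suc (nat (hi - lo)) * hsym_trunc (Suc N) (lo - 1 - k)
    = (\<Sum>v\<in>{lo..hi}. var N ^ nat (hi - v) * hsym_trunc N (v - k))"
proof -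
  have S: "(\<Sum>v\<in>{lo..hi}. var N ^ nat (hi - v) * hsym_trunc N (v - k))
      = (\<Sum>t<Suc (nat (hi - lo)). var N ^ t * hsym_trunc N (hi - k - int t))"
    by (rule sum.reindex_bij_witness[of _ "\<lambda>t. hi - int t" "\<lambda>v. nat (hi - v)"]) (use assms in \<open>auto simp: algebra_simps\<close>)
  have d: "lo - 1 - k = hi - k - int (Suc (nat (hi - lo)))"
    using assms by simp
  show ?thesis
    unfolding S d by (rule hsym_trunc_Suc_iterate)
qed

text \<open>The last row has no successor to subtract. Since \<open>L (n - 1) = 0\<close>, its
  entries have indices at most \<open>0\<close> and do not depend on the number of variables, so it
  can stay as it is.\<close>

lemma hdet_hsym_trunc_Suc:
  fixes L M :: "nat \<Rightarrow> int"
  assumes L: "\<And>i. L (Suc i) \<le> L i" "L n = 0" "L (n - 1) = 0" and M: "\<And>j. 0 \<le> M j"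
  shows "hdet (hsym_trunc (Suc N)) n (\<lambda>i. L i - int i) (\<lambda>j. M j - int j) =
    (\<Sum>f\<in>PiE {0..<n} (\<lambda>i. {L (Suc i)..L i}).
       (\<Prod>i=0..<n. var N ^ nat (L i - f i)) * hdet (hsym_trunc N) n (\<lambda>i. f i - int i) (\<lambda>j. M j - int j))"
proof -
  define x :: "'a mfps" where "x = var N"
  \<comment> \<open>The amount by which the indices in rows \<open>i\<close> and
    \<open>Suc i\<close> of \<open>A\<close> differ.\<close>
  define e where "e i = Suc (nat (L i - L (Suc i)))" for i
  define A :: "'a mfps mat" where "A = mat n n (\<lambda>(i, j). hsym_trunc (Suc N) (L i - int i - (M j - int j)))"
  \<comment> \<open>Multiplying by \<open>U\<close> from the left subtracts \<open>x ^ e i\<close>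
    times row \<open>Suc i\<close> from row \<open>i\<close>. \<open>U\<close> is unitriangular, so
    the determinant is kept.\<close>
  define U :: "'a mfps mat" where "U = mat n n (\<lambda>(i, j). if j = i then 1 else if j = Suc i then - (x ^ e i) else 0)"
  define B :: "'a mfps mat" where
    "B = mat n n (\<lambda>(i, j). \<Sum>v\<in>{L (Suc i)..L i}. x ^ nat (L i - v) * hsym_trunc N (v - int i - (M j - int j)))"
  have A: "A \<in> carrier_mat n n" and U: "U \<in> carrier_mat n n"
    by (simp_all add: A_def U_def)
  have "det U = 1"
    by (subst det_upper_triangular[OF _ U])
      (auto simp: U_def prod_list_diag_prod)
  moreover have "U * A = B"
  proof (rule eq_matI)
    fix i j assume "i < dim_row B" "j < dim_col B"
    then have ij: "i < n" "j < n"
      by (simp_all add: B_def)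
    have "(U * A) $$ (i, j) = (\<Sum>k=0..<n. U $$ (i, k) * A $$ (k, j))"
      using ij by (simp add: times_mat_def scalar_prod_def A_def U_def)
    also have "\<dots> = (\<Sum>k=0..<n. if k = i then A $$ (i, j) else if k = Suc i then - (x ^ e i * A $$ (Suc i, j)) else 0)"
      using ij by (intro sum.cong) (auto simp: U_def)
    also have "\<dots> = A $$ (i, j) + (\<Sum>k\<in>{0..<n} - {i}. if k = Suc i then - (x ^ e i * A $$ (Suc i, j)) else 0)"
      using ij by (subst sum.remove[of _ i]) auto
    also have "\<dots> = A $$ (i, j) - (if Suc i < n then x ^ e i * A $$ (Suc i, j) else 0)"
      by simp
    also have "\<dots> = B $$ (i, j)"
    proof (cases "Suc i < n")
      case True
      show ?thesis
        using hsym_trunc_Suc_interval[OF L(1)[of i], of N "int i + M j - int j"] ij True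
        by (simp add: A_def B_def e_def x_def algebra_simps)
    next
      case False
      then have "i = n - 1" "n > 0"
        using ij by auto
      moreover from this have "L (Suc i) = 0" "L i = 0"
        using L by auto
      ultimately show ?thesis
        using ij M[of j] by (simp add: A_def B_def hsym_trunc_nonpos)
    qed
    finally show "(U * A) $$ (i, j) = B $$ (i, j)" .
  qed (simp_all add: U_def A_def B_def)
  ultimately have "det A = det B"
    using det_mult[OF U A] by simp
  also have "det B = (\<Sum>p\<in>{p. p permutes {0..<n}}. signof p *
      (\<Prod>i=0..<n. \<Sum>v\<in>{L (Suc i)..L i}. x ^ nat (L i - v) * hsym_trunc N (v - int i - (M (p i) - int (p i)))))"
    by (subst det_def'[of _ n]) (auto intro!: sum.cong prod.cong simp: permutes_in_image B_def)
  \<comment> \<open>Distributing the product over the sums chooses one length \<open>f i\<close> per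
    row, from a range that does not depend on \<open>p\<close>.\<close>
  also have "\<dots> = (\<Sum>p\<in>{p. p permutes {0..<n}}. \<Sum>f\<in>PiE {0..<n} (\<lambda>i. {L (Suc i)..L i}). signof p *
      (\<Prod>i=0..<n. x ^ nat (L i - f i) * hsym_trunc N (f i - int i - (M (p i) - int (p i)))))"
    by (simp add: prod_sum_PiE sum_distrib_left)
  also have "\<dots> = (\<Sum>f\<in>PiE {0..<n} (\<lambda>i. {L (Suc i)..L i}).
       (\<Prod>i=0..<n. x ^ nat (L i - f i)) * hdet (hsym_trunc N) n (\<lambda>i. f i - int i) (\<lambda>j. M j - int j))"
    by (subst sum.swap) (simp add: hdet_expand prod.distrib sum_distrib_left mult_ac)
  finally show ?thesis
    by (simp add: hdet_def A_def x_def)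
qed

text \<open>Without variables only index \<open>0\<close> gives a nonzero complete function, so the
  entries test whether \<open>r i = c j\<close>. By strict monotonicity the matrix is the identity
  or has a zero row or a zero column.\<close>

lemma hdet_hsym_trunc_0:
  fixes r c :: "nat \<Rightarrow> int"
  assumes r: "\<And>i j. i < j \<Longrightarrow> j < n \<Longrightarrow> r j < r i" and c: "\<And>i j. i < j \<Longrightarrow> j < n \<Longrightarrow> c j < c i"
  shows "hdet (hsym_trunc 0) n r c = ((if \<forall>i<n. r i = c i then 1 else 0) :: 'a :: comm_ring_1 mfps)"
proof -
  have h: "hsym_trunc 0 k = ((if k = 0 then 1 else 0) :: 'a mfps)" for k
    by (rule mfps_eqI) (auto simp: coeff_hsym_trunc one_mfps.rep_eq zero_mfps.rep_eq mon_degree_def)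
  show ?thesis
  proof (cases "\<forall>i<n. r i = c i")
    case True
    then have "r i = c j \<longleftrightarrow> i = j" if "i < n" "j < n" for i j
      using that c[of i j] c[of j i] by (cases i j rule: linorder_cases) auto
    then have "mat n n (\<lambda>(i, j). hsym_trunc 0 (r i - c j)) = (1\<^sub>m n :: 'a mfps mat)"
      by (intro eq_matI) (auto simp: h)
    with True show ?thesis
      by (simp add: hdet_def)
  next
    case False
    define i where "i = (LEAST i. i < n \<and> r i \<noteq> c i)"
    have i: "i < n" "r i \<noteq> c i"
      using False LeastI_ex[of "\<lambda>i. i < n \<and> r i \<noteq> c i"] by (auto simp: i_def)
    have less: "r j = c j" if "j < i" for j
      using not_less_Least[OF that[unfolded i_def]] that i by auto
    \<comment> \<open>The larger of the two values at the first disagreement does not occur in the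
      other sequence: there the earlier entries are common to both and larger, the entries from
      \<open>i\<close> on are smaller.\<close>
    have "(\<forall>j<n. r i \<noteq> c j) \<or> (\<forall>j<n. r j \<noteq> c i)"
    proof (cases "r i > c i")
      case True
      have "r i \<noteq> c j" if "j < n" for j
        using True that less[of j] r[of j i] c[of i j] i by (cases i j rule: linorder_cases) auto
      then show ?thesis by blast
    next
      case False
      have "r j \<noteq> c i" if "j < n" for j
        using False that less[of j] c[of j i] r[of i j] i by (cases i j rule: linorder_cases) auto
      then show ?thesis by blast
    qed
    moreover have "(\<Prod>k=0..<n. hsym_trunc 0 (r k - c (p k))) = (0 :: 'a mfps)" if "p permutes {0..<n}" "\<forall>j<n. r i \<noteq> c j" for p
    proof (rule prod_zero)
      have "p i < n" using permutes_in_image[OF that(1), of i] i by simp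
      then show "\<exists>k\<in>{0..<n}. hsym_trunc 0 (r k - c (p k)) = (0 :: 'a mfps)"
        using i that(2) by (intro bexI[of _ i]) (auto simp: h)
    qed simp
    moreover have "(\<Prod>k=0..<n. hsym_trunc 0 (r k - c (p k))) = (0 :: 'a mfps)" if p: "p permutes {0..<n}" and rc: "\<forall>j<n. r j \<noteq> c i" for p
    proof (rule prod_zero)
      have "i \<in> p ` {0..<n}"
        using permutes_image[OF p] i by simp
      then obtain k where "k < n" "p k = i"
        by auto
      then show "\<exists>k\<in>{0..<n}. hsym_trunc 0 (r k - c (p k)) = (0 :: 'a mfps)"
        using i rc by (intro bexI[of _ k]) (auto simp: h)
    qed simp
    ultimately have "hdet (hsym_trunc 0) n r c = (0 :: 'a mfps)"
      unfolding hdet_expand by (intro sum.neutral) auto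
    with False show ?thesis by simp
  qed
qed

section \<open>Branching of tableaux\<close>

text \<open>The elements are the inner shapes \<open>nu\<close>, not the strips. For a partition
  \<open>lam\<close>, the interlacing inequalities allow at most one cell of \<open>lam\<close>
  outside \<open>nu\<close> in each column.\<close>

definition horizontal_strips :: "(nat \<Rightarrow>\<^sub>0 int) \<Rightarrow> (nat \<Rightarrow>\<^sub>0 int) set" where
  "horizontal_strips lam = {nu. \<forall>i. lookup lam (Suc i) \<le> lookup nu i \<and> lookup nu i \<le> lookup lam i}"

text \<open>A weakly decreasing sequence with finite support ends in zeros and is therefore
  nonnegative.\<close>

lemma is_partition_Suc: "is_partition lam \<longleftrightarrow> (\<forall>i. lookup lam (Suc i) \<le> lookup lam i)"
proof (safe)
  assume *: "\<forall>i. lookup lam (Suc i) \<le> lookup lam i"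
  have mono: "lookup lam j \<le> lookup lam i" if "i \<le> j" for i j
    using that by (rule lift_Suc_antimono_le[rotated]) (use * in auto)
  obtain k where k: "\<forall>i\<in>keys lam. i < k"
    using finite_nat_set_iff_bounded[of "keys lam"] by auto
  have "0 \<le> lookup lam i" for i
  proof -
    have "max i k \<notin> keys lam" using k by force
    then show ?thesis using mono[of i "max i k"] by (simp add: in_keys_iff)
  qed
  with mono show "is_partition lam"
    by (auto simp: is_partition_def)
qed (simp add: is_partition_def)

lemma horizontal_strips_partition:
  assumes "nu \<in> horizontal_strips lam"
  shows "is_partition nu"
  unfolding is_partition_Suc
proof
  fix i
  have "lookup nu (Suc i) \<le> lookup lam (Suc i)" "lookup lam (Suc i) \<le> lookup nu i"
    using assms by (simp_all add: horizontal_strips_def)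
  then show "lookup nu (Suc i) \<le> lookup nu i"
    by simp
qed

lemma lookup_mono_partition: "is_partition lam \<Longrightarrow> i \<le> j \<Longrightarrow> lookup lam j \<le> lookup lam i"
  and lookup_nonneg_partition: "is_partition lam \<Longrightarrow> 0 \<le> lookup lam i"
  by (auto simp: is_partition_def)

text \<open>The row lengths vary independently, and rows from \<open>n\<close> on are squeezed
  between zeros. The target is the index set in \<open>hdet_hsym_trunc_Suc\<close>.\<close>

lemma horizontal_strips_bij:
  assumes lam: "is_partition lam" and n: "\<And>i. i \<ge> n \<Longrightarrow> lookup lam i = 0"
  shows "bij_betw (\<lambda>nu. restrict (lookup nu) {0..<n}) (horizontal_strips lam)
           (PiE {0..<n} (\<lambda>i. {lookup lam (Suc i)..lookup lam i}))"
proof -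
  define g :: "(nat \<Rightarrow> int) \<Rightarrow> (nat \<Rightarrow>\<^sub>0 int)" where "g f = Abs_poly_mapping (\<lambda>i. if i < n then f i else 0)" for f
  have g: "lookup (g f) = (\<lambda>i. if i < n then f i else 0)" for f
    unfolding g_def by (rule lookup_Abs_poly_mapping) (rule finite_subset[of _ "{..<n}"], auto)
  have zero: "lookup nu i = 0" if "nu \<in> horizontal_strips lam" "\<not> i < n" for nu i
  proof -
    have "lookup lam (Suc i) \<le> lookup nu i" "lookup nu i \<le> lookup lam i"
      using that(1) by (auto simp: horizontal_strips_def)
    with that(2) show ?thesis using n[of i] n[of "Suc i"] by simp
  qed
  show ?thesis
  proof (rule bij_betwI[where g = g])
    show "g \<in> PiE {0..<n} (\<lambda>i. {lookup lam (Suc i)..lookup lam i}) \<rightarrow> horizontal_strips lam"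
      using n by (auto simp: horizontal_strips_def g PiE_def Pi_def)
    show "g (restrict (lookup nu) {0..<n}) = nu" if "nu \<in> horizontal_strips lam" for nu
      using zero[OF that] by (intro poly_mapping_eqI) (simp add: g)
    show "restrict (lookup (g f)) {0..<n} = f" if "f \<in> PiE {0..<n} (\<lambda>i. {lookup lam (Suc i)..lookup lam i})" for f
      using that by (auto simp: g PiE_def extensional_def)
  qed (auto simp: horizontal_strips_def)
qed

lemma finite_horizontal_strips:
  assumes "is_partition lam"
  shows "finite (horizontal_strips lam)"
proof -
  obtain n where "\<forall>i\<in>keys lam. i < n"
    using finite_nat_set_iff_bounded[of "keys lam"] by auto
  then have "lookup lam i = 0" if "i \<ge> n" for i
    using that by (meson in_keys_iff leD)
  then have "finite (horizontal_strips lam) \<longleftrightarrow> finite (PiE {0..<n} (\<lambda>i. {lookup lam (Suc i)..lookup lam i}))"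
    by (intro bij_betw_finite[OF horizontal_strips_bij[OF assms]])
  then show ?thesis
    by (simp add: finite_PiE)
qed

section \<open>Cells and contents of tableaux, and the filling of a strip\<close>

lemma card_skew_diagram:
  assumes n: "\<And>i. i \<ge> n \<Longrightarrow> lookup lam i = 0" and nu: "is_partition nu"
  shows "card (skew_diagram lam nu) = (\<Sum>i=0..<n. nat (lookup lam i - lookup nu i))"
proof -
  have nonneg: "0 \<le> lookup nu i" for i
    using nu by (rule lookup_nonneg_partition)
  have "skew_diagram lam nu = Sigma {0..<n} (\<lambda>i. {nat (lookup nu i)..<nat (lookup lam i)})"
  proof -
    have "(i, j) \<in> skew_diagram lam nu \<longleftrightarrow> (i, j) \<in> Sigma {0..<n} (\<lambda>i. {nat (lookup nu i)..<nat (lookup lam i)})" for i j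
      using n[of i] nonneg[of i] by (cases "i < n") (auto simp: skew_diagram_def)
    then show ?thesis by auto
  qed
  moreover have "nat (lookup lam i) - nat (lookup nu i) = nat (lookup lam i - lookup nu i)" for i
    using nonneg[of i] by linarith
  ultimately show ?thesis
    by simp
qed

lemma keys_tableau_monomial:
  assumes "finite (skew_diagram lam mu)"
  shows "keys (tableau_monomial lam mu T) = T ` skew_diagram lam mu"
  using assms
  by (auto simp: in_keys_iff tableau_monomial_def lookup_sum lookup_single when_def split: if_splits)

text \<open>In the uses below, the second argument is the inner shape \<open>nu\<close> of the
  strip, not the inner shape of the whole tableau.\<close>

definition fill_strip :: "(nat \<Rightarrow>\<^sub>0 int) \<Rightarrow> (nat \<Rightarrow>\<^sub>0 int) \<Rightarrow> nat \<Rightarrow> (nat \<times> nat \<Rightarrow> nat) \<Rightarrow> (nat \<times> nat \<Rightarrow> nat)" where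
  "fill_strip lam mu N T = (\<lambda>c. if c \<in> skew_diagram lam mu then N else T c)"

lemma skew_diagram_split:
  assumes "\<forall>i. lookup mu i \<le> lookup nu i" "\<forall>i. lookup nu i \<le> lookup lam i"
  shows "skew_diagram lam mu = skew_diagram nu mu \<union> skew_diagram lam nu"
    "skew_diagram nu mu \<inter> skew_diagram lam nu = {}"
proof -
  have "lookup mu i \<le> lookup nu i" "lookup nu i \<le> lookup lam i" for i
    using assms by auto
  then show "skew_diagram lam mu = skew_diagram nu mu \<union> skew_diagram lam nu"
    by (fastforce simp: skew_diagram_def intro: order_trans less_le_trans)
qed (auto simp: skew_diagram_def)

text \<open>\<open>N\<close> exceeds all old entries and is placed to their right in each row;
  columns stay strict because interlacing admits at most one new cell per column.\<close>

lemma ssyts_fill_strip: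
  assumes lam: "is_partition lam" and nu: "nu \<in> horizontal_strips lam" and sub: "\<forall>i. lookup mu i \<le> lookup nu i"
    and T: "T \<in> ssyts nu mu" and bound: "\<And>c. c \<in> skew_diagram nu mu \<Longrightarrow> T c < N"
  shows "fill_strip lam nu N T \<in> ssyts lam mu"
proof -
  have nu': "lookup lam (Suc i) \<le> lookup nu i" "lookup nu i \<le> lookup lam i" for i
    using nu by (auto simp: horizontal_strips_def)
  note split = skew_diagram_split[OF sub, of lam]
  have strip: "fill_strip lam nu N T c = (if c \<in> skew_diagram nu mu then T c else N)" if "c \<in> skew_diagram lam mu" for c
    using that split nu' by (auto simp: fill_strip_def)
  have left: "(i, j) \<in> skew_diagram nu mu"
    if "(i, j') \<in> skew_diagram nu mu" "(i, j) \<in> skew_diagram lam mu" "j < j'" for i j j'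
    using that by (auto simp: skew_diagram_def)
  \<comment> \<open>The chain is \<open>int j < lookup lam i' \<le> lookup lam (Suc i) \<le> lookup
    nu i\<close>.\<close>
  have above: "(i, j) \<in> skew_diagram nu mu"
    if "(i', j) \<in> skew_diagram lam mu" "(i, j) \<in> skew_diagram lam mu" "i < i'" for i i' j
    using that nu'(1)[of i] lookup_mono_partition[OF lam, of "Suc i" i'] by (auto simp: skew_diagram_def)
  show ?thesis
    unfolding ssyts_def
  proof (safe)
    show "fill_strip lam nu N T \<in> extensional (skew_diagram lam mu)"
      using T split nu' by (auto simp: ssyts_def extensional_def fill_strip_def)
  next
    fix i j j' assume c: "(i, j) \<in> skew_diagram lam mu" "(i, j') \<in> skew_diagram lam mu" and "j < j'"
    then show "fill_strip lam nu N T (i, j) \<le> fill_strip lam nu N T (i, j')"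
      using T left[OF _ c(1) \<open>j < j'\<close>] bound[of "(i, j)"] by (auto simp: strip ssyts_def)
  next
    fix i i' j assume c: "(i, j) \<in> skew_diagram lam mu" "(i', j) \<in> skew_diagram lam mu" and "i < i'"
    then show "fill_strip lam nu N T (i, j) < fill_strip lam nu N T (i', j)"
      using T above[OF c(2,1) \<open>i < i'\<close>] bound[of "(i, j)"] by (auto simp: strip ssyts_def)
  qed
qed

lemma sum_single_const: "finite A \<Longrightarrow> (\<Sum>c\<in>A. Poly_Mapping.single i (1 :: nat)) = Poly_Mapping.single i (card A)"
  by (induction A rule: finite_induct) (simp_all flip: single_add)

lemma tableau_monomial_fill_strip:
  assumes fin: "finite (skew_diagram lam mu)"
    and sub: "\<forall>i. lookup mu i \<le> lookup nu i" "\<forall>i. lookup nu i \<le> lookup lam i"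
  shows "tableau_monomial lam mu (fill_strip lam nu N T)
    = Poly_Mapping.single N (card (skew_diagram lam nu)) + tableau_monomial nu mu T"
proof -
  note split = skew_diagram_split[OF sub]
  have "finite (skew_diagram nu mu)" "finite (skew_diagram lam nu)"
    using fin split(1) by auto
  then have "tableau_monomial lam mu (fill_strip lam nu N T)
      = (\<Sum>c\<in>skew_diagram nu mu. Poly_Mapping.single (fill_strip lam nu N T c) 1)
        + (\<Sum>c\<in>skew_diagram lam nu. Poly_Mapping.single (fill_strip lam nu N T c) 1)"
    unfolding tableau_monomial_def split(1) using split(2) by (rule sum.union_disjoint)
  moreover have "(\<Sum>c\<in>skew_diagram nu mu. Poly_Mapping.single (fill_strip lam nu N T c) (1 :: nat)) = tableau_monomial nu mu T"
    unfolding tableau_monomial_def using split(2) by (intro sum.cong) (auto simp: fill_strip_def)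
  moreover have "(\<Sum>c\<in>skew_diagram lam nu. Poly_Mapping.single (fill_strip lam nu N T c) (1 :: nat))
      = Poly_Mapping.single N (card (skew_diagram lam nu))"
    using sum_single_const[OF \<open>finite (skew_diagram lam nu)\<close>] by (simp add: fill_strip_def del: sum_constant)
  ultimately show ?thesis
    by (simp add: add.commute)
qed

text \<open>Inverse of the filling: the entries below \<open>N\<close> form an initial segment of
  each row, and the end of this segment is taken as the row length of \<open>nu\<close>.\<close>

lemma ssyt_restrict:
  assumes lam: "is_partition lam" and mu: "is_partition mu" and sub: "\<forall>i. lookup mu i \<le> lookup lam i"
    and T: "T \<in> ssyts lam mu" and bound: "\<And>c. c \<in> skew_diagram lam mu \<Longrightarrow> T c \<le> N"
  obtains nu where "nu \<in> horizontal_strips lam" "\<forall>i. lookup mu i \<le> lookup nu i"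
    "restrict T (skew_diagram nu mu) \<in> ssyts nu mu" "\<And>c. c \<in> skew_diagram nu mu \<Longrightarrow> T c < N"
    "fill_strip lam nu N (restrict T (skew_diagram nu mu)) = T"
proof -
  have row: "T (i, j) \<le> T (i, j')" if "(i, j) \<in> skew_diagram lam mu" "(i, j') \<in> skew_diagram lam mu" "j \<le> j'" for i j j'
    using T that by (cases "j = j'") (auto simp: ssyts_def)
  have col: "T (i, j) < T (i', j)" if "(i, j) \<in> skew_diagram lam mu" "(i', j) \<in> skew_diagram lam mu" "i < i'" for i i' j
    using T that by (auto simp: ssyts_def)
  have "\<exists>k. lookup mu i \<le> k \<and> k \<le> lookup lam i \<and> (\<forall>j. (i, j) \<in> skew_diagram lam mu \<longrightarrow> (T (i, j) < N \<longleftrightarrow> int j < k))" for i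
  proof (cases "\<exists>j. (i, j) \<in> skew_diagram lam mu \<and> \<not> T (i, j) < N")
    case True
    define j0 where "j0 = (LEAST j. (i, j) \<in> skew_diagram lam mu \<and> \<not> T (i, j) < N)"
    have j0: "(i, j0) \<in> skew_diagram lam mu" "\<not> T (i, j0) < N"
      using LeastI_ex[OF True] by (auto simp: j0_def)
    have "T (i, j) < N \<longleftrightarrow> j < j0" if "(i, j) \<in> skew_diagram lam mu" for j
    proof
      show "T (i, j) < N" if "j < j0"
        using not_less_Least[OF that[unfolded j0_def]] \<open>(i, j) \<in> skew_diagram lam mu\<close> by auto
      show "j < j0" if "T (i, j) < N"
        using row[OF j0(1) \<open>(i, j) \<in> _\<close>] j0(2) that by (cases "j < j0") auto
    qed
    then show ?thesis
      using j0(1) by (intro exI[of _ "int j0"]) (auto simp: skew_diagram_def)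
  next
    \<comment> \<open>A row without entry \<open>N\<close> is kept whole; this includes rows without
      cells.\<close>
    case False
    then show ?thesis
      using sub by (intro exI[of _ "lookup lam i"]) (auto simp: skew_diagram_def)
  qed
  then obtain k where k: "\<And>i. lookup mu i \<le> k i" "\<And>i. k i \<le> lookup lam i"
    "\<And>i j. (i, j) \<in> skew_diagram lam mu \<Longrightarrow> T (i, j) < N \<longleftrightarrow> int j < k i"
    by metis
  define nu where "nu = Abs_poly_mapping k"
  \<comment> \<open>Outside the support of \<open>lam\<close>, \<open>k i\<close> is squeezed
    between \<open>lookup mu i \<ge> 0\<close> and \<open>0\<close>.\<close>
  have "k i = 0" if "i \<notin> keys lam" for i
    using that k(1,2)[of i] lookup_nonneg_partition[OF mu, of i] by (auto simp: in_keys_iff)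
  then have "{i. k i \<noteq> 0} \<subseteq> keys lam" by auto
  then have nu: "lookup nu = k"
    unfolding nu_def by (intro lookup_Abs_poly_mapping) (rule finite_subset, auto)
  have sub': "\<forall>i. lookup mu i \<le> lookup nu i" "\<forall>i. lookup nu i \<le> lookup lam i"
    using k nu by auto
  note split = skew_diagram_split[OF sub']
  \<comment> \<open>Otherwise the cell in column \<open>k i\<close> of row \<open>i\<close> has an
    entry at least \<open>N\<close>, and the cell below it one greater than
    \<open>N\<close>.\<close>
  have "lookup lam (Suc i) \<le> k i" for i
  proof (rule ccontr)
    assume *: "\<not> lookup lam (Suc i) \<le> k i"
    define j where "j = nat (k i)"
    have "int j = k i"
      using k(1)[of i] lookup_nonneg_partition[OF mu, of i] by (simp add: j_def)
    moreover from this have cells: "(i, j) \<in> skew_diagram lam mu" "(Suc i, j) \<in> skew_diagram lam mu"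
      using * k(1)[of i] lookup_mono_partition[OF mu, of i "Suc i"] lookup_mono_partition[OF lam, of i "Suc i"]
      by (auto simp: skew_diagram_def)
    ultimately show False
      using k(3)[of i j] col[OF cells] bound[OF cells(2)] by auto
  qed
  then have strip: "nu \<in> horizontal_strips lam"
    using sub' nu by (auto simp: horizontal_strips_def)
  have less: "T c < N" if "c \<in> skew_diagram nu mu" for c
    using that split(1) k(3) nu by (cases c) (auto simp: skew_diagram_def)
  have eq: "T c = N" if "c \<in> skew_diagram lam nu" for c
  proof -
    have "c \<in> skew_diagram lam mu" using that split(1) by auto
    moreover have "\<not> T c < N"
      using that calculation k(3) nu by (cases c) (auto simp: skew_diagram_def)
    ultimately show ?thesis using bound by (meson le_neq_implies_less)
  qed
  have "restrict T (skew_diagram nu mu) \<in> ssyts nu mu"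
    using row col split(1) by (auto simp: ssyts_def)
  moreover have "fill_strip lam nu N (restrict T (skew_diagram nu mu)) = T"
    using eq split T by (auto simp: fill_strip_def fun_eq_iff ssyts_def extensional_def)
  ultimately show thesis
    using that strip sub'(1) less by blast
qed

text \<open>Row \<open>i\<close> consists of the columns from \<open>lookup mu i\<close> up to its
  end, which can be read off because it does not lie before the start.\<close>

lemma skew_diagram_inject:
  assumes mu: "is_partition mu" and sub: "\<forall>i. lookup mu i \<le> lookup nu i" "\<forall>i. lookup mu i \<le> lookup rho i"
    and eq: "skew_diagram nu mu = skew_diagram rho mu"
  shows "nu = rho"
proof (rule poly_mapping_eqI)
  fix i
  have "lookup nu i \<le> lookup rho i"
    if sub: "\<forall>i. lookup mu i \<le> lookup rho i" and eq: "skew_diagram nu mu = skew_diagram rho mu" for nu rho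
  proof (rule ccontr)
    assume *: "\<not> lookup nu i \<le> lookup rho i"
    have "int (nat (lookup rho i)) = lookup rho i"
      using sub[rule_format, of i] lookup_nonneg_partition[OF mu, of i] by simp
    then have "(i, nat (lookup rho i)) \<in> skew_diagram nu mu" "(i, nat (lookup rho i)) \<notin> skew_diagram rho mu"
      using * sub by (auto simp: skew_diagram_def)
    with eq show False by simp
  qed
  from this[OF sub(2) eq] this[OF sub(1) eq[symmetric]] show "lookup nu i = lookup rho i"
    by simp
qed

text \<open>Filling strips with \<open>N\<close> is a bijection from the pairs
  \<open>(nu, T)\<close>: the cells with entries below \<open>N\<close> determine \<open>nu\<close>,
  and \<open>ssyt_restrict\<close> gives surjectivity.\<close>

lemma card_ssyts_branch:
  assumes lam: "is_partition lam" and mu: "is_partition mu" and sub: "\<forall>i. lookup mu i \<le> lookup lam i"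
    and m: "keys m \<subseteq> {..<Suc N}"
  shows "card {T \<in> ssyts lam mu. tableau_monomial lam mu T = m} =
    (\<Sum>nu\<in>{nu \<in> horizontal_strips lam. \<forall>i. lookup mu i \<le> lookup nu i}.
       card {T \<in> ssyts nu mu. keys (tableau_monomial nu mu T) \<subseteq> {..<N} \<and>
         Poly_Mapping.single N (card (skew_diagram lam nu)) + tableau_monomial nu mu T = m})"
proof -
  let ?H = "{nu \<in> horizontal_strips lam. \<forall>i. lookup mu i \<le> lookup nu i}"
  let ?B = "\<lambda>nu. {T \<in> ssyts nu mu. keys (tableau_monomial nu mu T) \<subseteq> {..<N} \<and>
         Poly_Mapping.single N (card (skew_diagram lam nu)) + tableau_monomial nu mu T = m}"
  let ?F = "\<lambda>(nu, T). fill_strip lam nu N T"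
  have H: "is_partition nu" "\<forall>i. lookup nu i \<le> lookup lam i" "\<forall>i. lookup mu i \<le> lookup nu i" if "nu \<in> ?H" for nu
    using that horizontal_strips_partition by (auto simp: horizontal_strips_def)
  have bound: "T c < N" if "nu \<in> ?H" "T \<in> ?B nu" "c \<in> skew_diagram nu mu" for nu T c
    using that keys_tableau_monomial[OF finite_skew_diagram[OF H(1)[OF that(1)] mu], of T] by auto
  have fin: "finite (?B nu)" if "nu \<in> ?H" for nu
  proof (rule finite_subset)
    show "?B nu \<subseteq> {T \<in> ssyts nu mu. tableau_monomial nu mu T = m - Poly_Mapping.single N (card (skew_diagram lam nu))}"
      by auto
  qed (rule finite_ssyts_of_content[OF H(1)[OF that] mu])
  have restr: "skew_diagram nu mu = {c \<in> skew_diagram lam mu. fill_strip lam nu N T c < N}"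
    if "nu \<in> ?H" "T \<in> ?B nu" for nu T
    using bound[OF that] skew_diagram_split[OF H(3,2)[OF that(1)]] by (auto simp: fill_strip_def)
  have inj: "inj_on ?F (Sigma ?H ?B)"
  proof (rule inj_onI, clarify)
    fix nu T rho S
    assume nu: "nu \<in> horizontal_strips lam" "\<forall>i. lookup mu i \<le> lookup nu i"
      and rho: "rho \<in> horizontal_strips lam" "\<forall>i. lookup mu i \<le> lookup rho i"
      and eq: "fill_strip lam nu N T = fill_strip lam rho N S"
      and T: "T \<in> ssyts nu mu" "keys (tableau_monomial nu mu T) \<subseteq> {..<N}"
        "m = Poly_Mapping.single N (card (skew_diagram lam nu)) + tableau_monomial nu mu T"
      and S: "S \<in> ssyts rho mu" "keys (tableau_monomial rho mu S) \<subseteq> {..<N}"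
        "Poly_Mapping.single N (card (skew_diagram lam rho)) + tableau_monomial rho mu S
          = Poly_Mapping.single N (card (skew_diagram lam nu)) + tableau_monomial nu mu T"
    have "skew_diagram nu mu = skew_diagram rho mu"
      using restr[of nu T] restr[of rho S] nu rho T S eq by auto
    then have [simp]: "rho = nu"
      using skew_diagram_inject[OF mu rho(2) nu(2)] by simp
    \<comment> \<open>On the strip the filling hides the old values, but there both tableaux are
      \<open>undefined\<close> by extensionality.\<close>
    have "T c = S c" for c
    proof (cases "c \<in> skew_diagram lam nu")
      case True
      then have "c \<notin> skew_diagram nu mu" by (auto simp: skew_diagram_def)
      then show ?thesis using T(1) S(1) by (cases c) (auto simp: ssyts_def extensional_def)
    next
      case False
      then show ?thesis using fun_cong[OF eq, of c] by (simp add: fill_strip_def)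
    qed
    then show "nu = rho \<and> T = S" by auto
  qed
  have "?F ` Sigma ?H ?B = {T \<in> ssyts lam mu. tableau_monomial lam mu T = m}" (is "_ = ?A")
  proof (intro equalityI subsetI)
    fix T' assume "T' \<in> ?F ` Sigma ?H ?B"
    then obtain nu T where nT: "nu \<in> ?H" "T \<in> ?B nu" "T' = fill_strip lam nu N T"
      by auto
    then show "T' \<in> ?A"
      using ssyts_fill_strip[OF lam _ _ _ bound[OF nT(1,2)]] H[OF nT(1)]
        tableau_monomial_fill_strip[OF finite_skew_diagram[OF lam mu], of nu N T]
      by auto
  next
    fix T assume T: "T \<in> ?A"
    have "T c \<le> N" if "c \<in> skew_diagram lam mu" for c
      using T m that keys_tableau_monomial[OF finite_skew_diagram[OF lam mu], of T] by force
    then obtain nu where nu: "nu \<in> horizontal_strips lam" "\<forall>i. lookup mu i \<le> lookup nu i"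
      "restrict T (skew_diagram nu mu) \<in> ssyts nu mu" "\<And>c. c \<in> skew_diagram nu mu \<Longrightarrow> T c < N"
      "fill_strip lam nu N (restrict T (skew_diagram nu mu)) = T"
      using ssyt_restrict[OF lam mu sub, of T N] T by auto
    then have nuH: "nu \<in> ?H" by auto
    have "restrict T (skew_diagram nu mu) \<in> ?B nu"
      using nu T keys_tableau_monomial[OF finite_skew_diagram[OF H(1)[OF nuH] mu]] H[OF nuH]
        tableau_monomial_fill_strip[OF finite_skew_diagram[OF lam mu], of nu N "restrict T (skew_diagram nu mu)"]
      by auto
    then show "T \<in> ?F ` Sigma ?H ?B"
      using nuH nu(5) by (intro image_eqI[of _ _ "(nu, restrict T (skew_diagram nu mu))"]) auto
  qed
  then have "card ?A = card (Sigma ?H ?B)"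
    using card_image[OF inj] by simp
  also have "\<dots> = (\<Sum>nu\<in>?H. card (?B nu))"
    using fin finite_horizontal_strips[OF lam] by (intro card_SigmaI) auto
  finally show ?thesis .
qed

text \<open>The sum may range over all interlacing \<open>nu\<close>, since
  \<open>skew_schur nu mu\<close> is zero unless \<open>nu\<close> contains
  \<open>mu\<close>.\<close>

lemma skew_schur_branch:
  assumes lam: "is_partition lam" and mu: "is_partition mu"
  shows "trunc (Suc N) (skew_schur lam mu :: 'k :: comm_ring_1 mfps) =
    (\<Sum>nu\<in>horizontal_strips lam. var N ^ card (skew_diagram lam nu) * trunc N (skew_schur nu mu))"
proof (rule mfps_eqI)
  fix m
  let ?d = "\<lambda>nu. Poly_Mapping.single N (card (skew_diagram lam nu))"
  let ?B = "\<lambda>nu. {T \<in> ssyts nu mu. keys (tableau_monomial nu mu T) \<subseteq> {..<N} \<and> ?d nu + tableau_monomial nu mu T = m}"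
  \<comment> \<open>Multiplying by a power of \<open>var N\<close> selects the only cofactor
    \<open>v\<close> of \<open>m\<close>, if there is one; \<open>?B nu\<close> then consists of the
    tableaux of content \<open>v\<close>.\<close>
  have summand: "coeff (var N ^ card (skew_diagram lam nu) * trunc N (skew_schur nu mu)) m
      = (if (\<forall>i. lookup mu i \<le> lookup nu i) \<and> keys m \<subseteq> {..<Suc N} then of_nat (card (?B nu)) else (0 :: 'k))" for nu
  proof (cases "\<exists>v. ?d nu + v = m \<and> keys v \<subseteq> {..<N}")
    case True
    then obtain v where v: "?d nu + v = m" "keys v \<subseteq> {..<N}" by blast
    then have "{w. ?d nu + w = m} = {v}" by auto
    moreover have "?B nu = {T \<in> ssyts nu mu. tableau_monomial nu mu T = v}"
      using v by auto
    moreover have "keys m \<subseteq> {..<Suc N}"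
      using v by (auto simp: keys_add_nat less_Suc_eq subset_iff split: if_splits)
    ultimately show ?thesis
      using v by (simp add: var_power coeff_mono_times trunc.rep_eq skew_schur.rep_eq)
  next
    case False
    then have B: "?B nu = {}" by auto
    have "coeff (var N ^ card (skew_diagram lam nu) * trunc N (skew_schur nu mu)) m = (0 :: 'k)"
      unfolding var_power coeff_mono_times
      by (rule sum.neutral) (use False in \<open>auto simp: trunc.rep_eq\<close>)
    then show ?thesis
      unfolding B by simp
  qed
  have "coeff (trunc (Suc N) (skew_schur lam mu)) m
      = (if keys m \<subseteq> {..<Suc N} then \<Sum>nu\<in>{nu \<in> horizontal_strips lam. \<forall>i. lookup mu i \<le> lookup nu i}. of_nat (card (?B nu)) else (0 :: 'k))"
  proof (cases "\<forall>i. lookup mu i \<le> lookup lam i")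
    case True
    then show ?thesis
      by (simp add: trunc.rep_eq skew_schur.rep_eq card_ssyts_branch[OF lam mu True])
  next
    case False
    \<comment> \<open>If \<open>lam\<close> does not contain \<open>mu\<close>, then no smaller
      \<open>nu\<close> does.\<close>
    then have none: "{nu \<in> horizontal_strips lam. \<forall>i. lookup mu i \<le> lookup nu i} = {}"
      by (auto simp: horizontal_strips_def) (meson order_trans)
    have "coeff (skew_schur lam mu) m = (0 :: 'k)"
      unfolding skew_schur.rep_eq by (rule if_not_P[OF False])
    then show ?thesis
      unfolding none by (simp add: trunc.rep_eq)
  qed
  also have "\<dots> = (\<Sum>nu\<in>horizontal_strips lam. if (\<forall>i. lookup mu i \<le> lookup nu i) \<and> keys m \<subseteq> {..<Suc N} then of_nat (card (?B nu)) else 0)"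
    using finite_horizontal_strips[OF lam] by (simp add: sum.inter_filter)
  finally show "coeff (trunc (Suc N) (skew_schur lam mu)) m =
    coeff (\<Sum>nu\<in>horizontal_strips lam. var N ^ card (skew_diagram lam nu) * trunc N (skew_schur nu mu) :: 'k mfps) m"
    by (simp add: coeff_sum summand)
qed

section \<open>The Jacobi-Trudi formula\<close>

text \<open>Both sides obey the same branching recursion, with \<open>mu\<close> fixed and
  \<open>lam\<close> varying. The bound \<open>n - 1\<close> keeps a zero part in the last row, as
  \<open>hdet_hsym_trunc_Suc\<close> requires.\<close>

lemma trunc_skew_schur_eq_hdet:
  assumes lam: "is_partition lam" and mu: "is_partition mu"
    and n: "n > 0" "\<And>i. i \<ge> n - 1 \<Longrightarrow> lookup lam i = 0" "\<And>i. i \<ge> n - 1 \<Longrightarrow> lookup mu i = 0"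
  shows "trunc N (skew_schur lam mu :: 'k :: comm_ring_1 mfps)
    = hdet (hsym_trunc N) n (\<lambda>i. lookup lam i - int i) (\<lambda>j. lookup mu j - int j)"
  using lam n(2)
proof (induction N arbitrary: lam)
  case 0
  note lam = \<open>is_partition lam\<close>
  have "lookup lam i = lookup mu i" if "\<forall>i<n. lookup lam i = lookup mu i" for i
    using that n 0(2)[of i] by (cases "i < n") auto
  then have eq: "(\<forall>i<n. lookup lam i = lookup mu i) \<longleftrightarrow> lam = mu"
    by (auto intro!: poly_mapping_eqI)
  have "hdet (hsym_trunc 0) n (\<lambda>i. lookup lam i - int i) (\<lambda>j. lookup mu j - int j) = ((if lam = mu then 1 else 0) :: 'k mfps)"
  proof (subst hdet_hsym_trunc_0)
    show "lookup lam j - int j < lookup lam i - int i" "lookup mu j - int j < lookup mu i - int i" if "i < j" for i j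
      using that lookup_mono_partition[OF lam, of i j] lookup_mono_partition[OF mu, of i j] by simp_all
  qed (simp add: eq)
  moreover have "trunc 0 (skew_schur lam mu) = ((if lam = mu then 1 else 0) :: 'k mfps)"
  proof (rule mfps_eqI)
    fix m
    show "coeff (trunc 0 (skew_schur lam mu)) m = coeff ((if lam = mu then 1 else 0) :: 'k mfps) m"
    proof (cases "m = 0 \<and> (\<forall>i. lookup mu i \<le> lookup lam i)")
      case True
      show ?thesis
      proof (cases "lam = mu")
        case eq: True
        have "skew_diagram mu mu = {}" by (auto simp: skew_diagram_def)
        then have "{T \<in> ssyts mu mu. tableau_monomial mu mu T = 0} = {\<lambda>_. undefined}"
          by (auto simp: ssyts_def tableau_monomial_def)
        with True eq show ?thesis
          by (simp add: trunc.rep_eq skew_schur.rep_eq one_mfps.rep_eq)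
      next
        case neq: False
        \<comment> \<open>A cell would put a variable into the content, so no tableau has content
          \<open>0\<close>.\<close>
        have "skew_diagram lam mu \<noteq> skew_diagram mu mu"
          using skew_diagram_inject[OF mu, of lam mu] True neq by auto
        moreover have "skew_diagram mu mu = {}" by (auto simp: skew_diagram_def)
        ultimately have "tableau_monomial lam mu T \<noteq> 0" for T
          using keys_tableau_monomial[OF finite_skew_diagram[OF lam mu], of T] by auto
        with True neq show ?thesis
          by (simp add: trunc.rep_eq skew_schur.rep_eq zero_mfps.rep_eq)
      qed
    qed (auto simp: trunc.rep_eq skew_schur.rep_eq one_mfps.rep_eq zero_mfps.rep_eq)
  qed
  ultimately show ?case by simp
next
  case (Suc N)
  note lam = \<open>is_partition lam\<close>
  let ?c = "\<lambda>j. lookup mu j - int j"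
  have IH: "trunc N (skew_schur nu mu :: 'k mfps) = hdet (hsym_trunc N) n (\<lambda>i. lookup nu i - int i) ?c"
    if nu: "nu \<in> horizontal_strips lam" for nu
  proof (rule Suc.IH)
    show "is_partition nu" using nu by (rule horizontal_strips_partition)
    show "lookup nu i = 0" if "i \<ge> n - 1" for i
    proof -
      have "lookup lam (Suc i) \<le> lookup nu i" "lookup nu i \<le> lookup lam i"
        using nu by (auto simp: horizontal_strips_def)
      then show ?thesis
        using Suc.prems(2)[of i] Suc.prems(2)[of "Suc i"] that by simp
    qed
  qed
  have zero: "lookup lam i = 0" if "i \<ge> n" for i
    using Suc.prems(2) that by auto
  have "trunc (Suc N) (skew_schur lam mu :: 'k mfps)
      = (\<Sum>nu\<in>horizontal_strips lam. var N ^ card (skew_diagram lam nu) * trunc N (skew_schur nu mu))"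
    by (rule skew_schur_branch[OF lam mu])
  \<comment> \<open>Restricting \<open>lookup nu\<close> to \<open>{0..<n}\<close> prepares the
    reindexing along \<open>horizontal_strips_bij\<close>.\<close>
  also have "\<dots> = (\<Sum>nu\<in>horizontal_strips lam. (\<Prod>i=0..<n. var N ^ nat (lookup lam i - restrict (lookup nu) {0..<n} i))
      * hdet (hsym_trunc N) n (\<lambda>i. restrict (lookup nu) {0..<n} i - int i) ?c)"
  proof (rule sum.cong[OF refl])
    fix nu assume nu: "nu \<in> horizontal_strips lam"
    have "hdet (hsym_trunc N) n (\<lambda>i. restrict (lookup nu) {0..<n} i - int i) ?c
        = (hdet (hsym_trunc N) n (\<lambda>i. lookup nu i - int i) ?c :: 'k mfps)"
      unfolding hdet_expand by (intro sum.cong prod.cong arg_cong2[of _ _ _ _ "(*)"]) auto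
    then show "var N ^ card (skew_diagram lam nu) * trunc N (skew_schur nu mu)
        = (\<Prod>i=0..<n. var N ^ nat (lookup lam i - restrict (lookup nu) {0..<n} i))
          * (hdet (hsym_trunc N) n (\<lambda>i. restrict (lookup nu) {0..<n} i - int i) ?c :: 'k mfps)"
      using card_skew_diagram[OF zero horizontal_strips_partition[OF nu]]
      by (simp add: IH[OF nu] power_sum)
  qed
  also have "\<dots> = (\<Sum>f\<in>PiE {0..<n} (\<lambda>i. {lookup lam (Suc i)..lookup lam i}).
      (\<Prod>i=0..<n. var N ^ nat (lookup lam i - f i)) * hdet (hsym_trunc N) n (\<lambda>i. f i - int i) ?c)"
    by (rule sum.reindex_bij_betw[OF horizontal_strips_bij[OF lam zero]])
  also have "\<dots> = hdet (hsym_trunc (Suc N)) n (\<lambda>i. lookup lam i - int i) ?c"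
    using lookup_mono_partition[OF lam] lookup_nonneg_partition[OF mu] Suc.prems(2)
    by (subst hdet_hsym_trunc_Suc) auto
  finally show ?case .
qed

text \<open>A monomial involves finitely many variables, so its coefficient survives truncation at a
  large enough \<open>N\<close>.\<close>

theorem jacobi_trudi:
  assumes "is_partition lam" "is_partition mu" "n > 0"
    "\<And>i. i \<ge> n - 1 \<Longrightarrow> lookup lam i = 0" "\<And>i. i \<ge> n - 1 \<Longrightarrow> lookup mu i = 0"
  shows "(skew_schur lam mu :: 'k :: comm_ring_1 mfps)
    = hdet hsym_int n (\<lambda>i. lookup lam i - int i) (\<lambda>j. lookup mu j - int j)"
proof (rule mfps_eqI)
  fix m :: monomial
  obtain N where "\<forall>i\<in>keys m. i < N"
    using finite_nat_set_iff_bounded[of "keys m"] by auto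
  then have trunc: "coeff f m = coeff (trunc N f) m" for f :: "'k mfps"
    by (auto simp: trunc.rep_eq)
  have trunc_hdet: "hdet (hsym_trunc N) n r c = trunc N (hdet hsym_int n r c :: 'k mfps)" for r c
    by (simp add: hdet_hom[OF comm_ring_hom_trunc] hsym_trunc_def[abs_def])
  show "coeff (skew_schur lam mu) m
    = coeff (hdet hsym_int n (\<lambda>i. lookup lam i - int i) (\<lambda>j. lookup mu j - int j) :: 'k mfps) m"
    by (subst (1 2) trunc) (simp only: trunc_skew_schur_eq_hdet[OF assms] trunc_hdet)
qed

theorem theorem3:
  fixes q a b :: "'k :: comm_ring_1"
    and nabla :: "'k mfps \<Rightarrow> 'k mfps"
    and lam mu :: "nat \<Rightarrow>\<^sub>0 int"
    and l m :: "nat \<Rightarrow> int"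
  assumes nabla: "is_nabla q nabla"
    and ab: "a + b = q - 1"
    and lam: "is_partition lam"
    and mu: "is_partition mu"
    and l: "\<And>i. l i = lookup lam i - int (i + 1)"
    and m: "\<And>i. m i = lookup mu i - int (i + 1)"
  shows "nabla (skew_schur lam mu) =
      (\<Sum>i\<in>{i. is_partition (lam - unit_seq i)}.
         smult (of_int (l i) + a) (skew_schur (lam - unit_seq i) mu))
    + (\<Sum>i\<in>{i. is_partition (mu + unit_seq i)}.
         smult (b - of_int (m i)) (skew_schur lam (mu + unit_seq i)))"
proof -
  obtain k where k: "\<forall>i\<in>keys lam \<union> keys mu. i < k"
    using finite_nat_set_iff_bounded[of "keys lam \<union> keys mu"] by auto
  have zero: "lookup lam i = 0" "lookup mu i = 0" if "i \<ge> k" for i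
    using k that by (meson Un_iff in_keys_iff leD)+
  \<comment> \<open>\<open>mu + unit_seq k\<close> can be nonzero at index \<open>k\<close>, and
    \<open>jacobi_trudi\<close> needs a zero part at the last index
    \<open>n - 1 = k + 1\<close>.\<close>
  define n where "n = k + 2"
  define r where "r i = lookup lam i - int i" for i
  define c where "c j = lookup mu j - int j" for j
  have n_pos: "n > 0"
    by (simp add: n_def)
  have zero': "lookup lam i = 0" "lookup mu i = 0" if "i \<ge> n - 1" for i
    using zero[of i] that by (auto simp: n_def)
  have r_eq: "(\<lambda>i. lookup lam i - int i) = r" and c_eq: "(\<lambda>j. lookup mu j - int j) = c"
    by (simp_all add: r_def c_def fun_eq_iff)
  have removable: "i < k" if "is_partition (lam - unit_seq i)" for i
    using zero(1)[of i] lookup_nonneg_partition[OF that, of i] by (force simp: lookup_minus)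
  have addable: "j \<le> k" if part: "is_partition (mu + unit_seq j)" for j
  proof (rule ccontr)
    assume "\<not> j \<le> k"
    then have "k < j" "lookup (mu + unit_seq j) j \<le> lookup (mu + unit_seq j) k"
      using part by (auto intro: lookup_mono_partition)
    then show False using zero(2)[of j] zero(2)[of k] by (simp add: lookup_add lookup_single)
  qed
  have less_n: "is_partition (lam - unit_seq i) \<Longrightarrow> i < n" "is_partition (mu + unit_seq i) \<Longrightarrow> i < n" for i
    using removable[of i] addable[of i] by (auto simp: n_def)
  have rows: "hdet hsym_int n (r(i := r i - 1)) c = (if is_partition (lam - unit_seq i) then skew_schur (lam - unit_seq i) mu else (0 :: 'k mfps))"
    if "i < n" for i
  proof (cases "is_partition (lam - unit_seq i)")
    case True
    then have "i < k" by (rule removable)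
    then have z: "lookup (lam - unit_seq i) j = 0" if "j \<ge> n - 1" for j
      using that zero(1)[of j] by (simp add: n_def lookup_minus lookup_single)
    have e: "(\<lambda>j. lookup (lam - unit_seq i) j - int j) = r(i := r i - 1)"
      by (auto simp: r_def lookup_minus lookup_single when_def)
    have "skew_schur (lam - unit_seq i) mu = (hdet hsym_int n (r(i := r i - 1)) c :: 'k mfps)"
      using jacobi_trudi[OF True mu n_pos z zero'(2)] unfolding e c_eq .
    then show ?thesis unfolding if_P[OF True] by (rule sym)
  next
    case False
    then obtain j where j: "lookup (lam - unit_seq i) j < lookup (lam - unit_seq i) (Suc j)"
      by (metis is_partition_Suc not_le)
    have mono: "lookup lam (Suc j) \<le> lookup lam j"
      using lam by (simp add: is_partition_Suc)
    \<comment> \<open>Removing a cell fails only if the next part is equal; then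
      \<open>r i - 1 = r (Suc i)\<close>, and two rows agree if row \<open>Suc i\<close>
      exists.\<close>
    with j have ij: "i = j" "lookup lam (Suc j) = lookup lam j"
      by (auto simp: lookup_minus lookup_single when_def split: if_splits)
    show ?thesis
    proof (cases "Suc i < n")
      case True
      then have "hdet hsym_int n (r(i := r i - 1)) c = (0 :: 'k mfps)"
        using ij by (intro hdet_eq_rows[of i n "Suc i"]) (auto simp: r_def)
      with False show ?thesis by simp
    next
      case last: False
      \<comment> \<open>The bottom row has no row below it to agree with. Its part is
        \<open>0\<close>, so lowering it makes all indices in this row negative and the row
        vanishes.\<close>
      then have i: "i = Suc k" using that by (simp add: n_def)
      have "hsym_int ((r(i := r i - 1)) i - c (p i)) = (0 :: 'k mfps)" if "p permutes {0..<n}" for p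
      proof -
        have "p i \<le> i" using permutes_in_image[OF that, of i] i by (simp add: n_def)
        then show ?thesis
          using zero(1)[of i] lookup_nonneg_partition[OF mu, of "p i"] i by (simp add: hsym_int_def r_def c_def)
      qed
      then have "(\<Prod>j=0..<n. hsym_int ((r(i := r i - 1)) j - c (p j))) = (0 :: 'k mfps)" if "p permutes {0..<n}" for p
        using that \<open>i < n\<close> by (intro prod_zero) (auto intro!: bexI[of _ i])
      then have "hdet hsym_int n (r(i := r i - 1)) c = (0 :: 'k mfps)"
        unfolding hdet_expand by (intro sum.neutral) auto
      with False show ?thesis by simp
    qed
  qed
  have cols: "hdet hsym_int n r (c(j := c j + 1)) = (if is_partition (mu + unit_seq j) then skew_schur lam (mu + unit_seq j) else (0 :: 'k mfps))"
    if "j < n" for j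
  proof (cases "is_partition (mu + unit_seq j)")
    case True
    then have "j \<le> k" by (rule addable)
    then have z: "lookup (mu + unit_seq j) i = 0" if "i \<ge> n - 1" for i
      using that zero(2)[of i] by (simp add: n_def lookup_add lookup_single)
    have e: "(\<lambda>i. lookup (mu + unit_seq j) i - int i) = c(j := c j + 1)"
      by (auto simp: c_def lookup_add lookup_single when_def)
    have "skew_schur lam (mu + unit_seq j) = (hdet hsym_int n r (c(j := c j + 1)) :: 'k mfps)"
      using jacobi_trudi[OF lam True n_pos zero'(1) z] unfolding e r_eq .
    then show ?thesis unfolding if_P[OF True] by (rule sym)
  next
    case False
    then obtain i where i: "lookup (mu + unit_seq j) i < lookup (mu + unit_seq j) (Suc i)"
      by (metis is_partition_Suc not_le)
    have "lookup mu (Suc i) \<le> lookup mu i"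
      using mu by (simp add: is_partition_Suc)
    \<comment> \<open>Here no boundary case arises: adding a cell can only fail below an equal part,
      so column \<open>j\<close> has a predecessor \<open>i\<close>, and
      \<open>c j + 1 = c i\<close>.\<close>
    with i have ij: "j = Suc i" "lookup mu (Suc i) = lookup mu i"
      by (auto simp: lookup_add lookup_single when_def split: if_splits)
    then have "hdet hsym_int n r (c(j := c j + 1)) = (0 :: 'k mfps)"
      using \<open>j < n\<close> by (intro hdet_eq_cols[of i n j]) (auto simp: c_def)
    with False show ?thesis by simp
  qed
  \<comment> \<open>\<open>r\<close> and \<open>c\<close> exceed \<open>l\<close> and \<open>m\<close> by one, since indices start at \<open>0\<close>.\<close>
  have shift: "of_int (r i) + (a - 1) = of_int (l i) + a" "(b + 1) - of_int (c i) = b - of_int (m i)" for i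
    by (simp_all add: r_def c_def l m)
  have "nabla (skew_schur lam mu) = nabla (hdet hsym_int n r c)"
    using jacobi_trudi[OF lam mu n_pos zero'] unfolding r_eq c_eq by (rule arg_cong)
  \<comment> \<open>Using \<open>a - 1\<close> and \<open>b + 1\<close> absorbs the shift and keeps
    the sum \<open>q - 1\<close>.\<close>
  also have "\<dots> = (\<Sum>i<n. smult (of_int (l i) + a) (hdet hsym_int n (r(i := r i - 1)) c))
      + (\<Sum>j<n. smult (b - of_int (m j)) (hdet hsym_int n r (c(j := c j + 1))))"
    using ab by (subst nabla_hdet[OF nabla, of "a - 1" "b + 1"]) (simp_all only: shift, simp)
  \<comment> \<open>Indices that give no partition contribute \<open>0\<close> by
    \<open>rows\<close>, and all others lie below \<open>n\<close>.\<close>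
  also have "(\<Sum>i<n. smult (of_int (l i) + a) (hdet hsym_int n (r(i := r i - 1)) c))
      = (\<Sum>i\<in>{i. is_partition (lam - unit_seq i)}. smult (of_int (l i) + a) (skew_schur (lam - unit_seq i) mu))"
    using less_n(1) by (intro sum.mono_neutral_cong_right) (auto simp: rows)
  also have "(\<Sum>j<n. smult (b - of_int (m j)) (hdet hsym_int n r (c(j := c j + 1))))
      = (\<Sum>j\<in>{j. is_partition (mu + unit_seq j)}. smult (b - of_int (m j)) (skew_schur lam (mu + unit_seq j)))"
    using less_n(2) by (intro sum.mono_neutral_cong_right) (auto simp: cols)
  finally show ?thesis .
qed

end
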